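(* Let $G$ be the graph constructed in the context. Then $G$ has (orientable) genus at least $3$ and non-orientable genus at least $3$.
   Context: A graph $H$ is hypohamiltonian if it is not Hamiltonian but $H-v$ is Hamiltonian for every vertex $v$. For each $i\in\{1,2,3\}$ let $H_i$ be a finite simple graph that is $3$-connected, cubic, non-planar and hypohamiltonian. Fix $z_i\in V(H_i)$ with neighbours $n_1,n_2,n_3$, and let $H_i^-=H_i-z_i$. Construct $G_i$ from $H_i$: delete the edges $z_in_1$, $z_in_2$; add new vertices $x_i,y_i$ and edges $n_1x_i$, $x_iz_i$, $n_2y_i$, $y_iz_i$, $x_iy_i$. Replace the three edges of the triangle $x_iy_iz_i$ by paths $x_ir_1g_1y_i$, $y_ir_2g_2z_i$, $z_ir_3g_3x_i$ through new vertices. Add a new vertex $x_i'$ adjacent to $r_1,r_2,r_3$. Add new vertices $y_i'$, $o_1,o_2,o_3$ with edges $y_i'o_j$, $o_jg_j$ ($j=1,2,3$). Add a new vertex $z_i'$ adjacent to $o_1,o_2,o_3$. Let $G_i^-=G_i-z_i'$ and denote $o_1,o_2,o_3$ (in an arbitrary fixed order) by $a_i,b_i,c_i$. The graph $G$ is obtained from the disjoint union of $G_1^-,G_2^-,G_3^-$ and a new vertex $x$ by adding the six edges $xa_1$, $xa_2$, $xa_3$, $b_1c_2$, $b_2c_3$, $b_3c_1$. *)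

theory Defs
  imports
    Graph_Theory.Graph_Theory
    "HOL-Combinatorics.Orbits"
    "HOL-Library.Extended_Nat"
begin

section \<open>Graphs\<close>

text \<open>
  A finite simple graph is a finite loop-free symmetric digraph without parallel arcs
  (\<open>pair_graph\<close>); an undirected edge is the pair of its two arcs.
\<close>

definition k_connected :: "nat \<Rightarrow> ('a, 'b) pre_digraph \<Rightarrow> bool" where
  "k_connected k G \<longleftrightarrow> k < card (verts G) \<and>
     (\<forall>X \<subseteq> verts G. card X < k \<longrightarrow> Digraph_Component.connected (G \<restriction> (verts G - X)))"

definition cubic :: "('a, 'b) pre_digraph \<Rightarrow> bool" where
  "cubic G \<longleftrightarrow> (\<forall>v \<in> verts G. out_degree G v = 3)"

text \<open>
  In a symmetric digraph \<open>pre_digraph.cycle\<close> also accepts the closed walks \<open>u, v, u\<close>;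
  the length condition excludes them.
\<close>

definition hamiltonian :: "('a, 'b) pre_digraph \<Rightarrow> bool" where
  "hamiltonian G \<longleftrightarrow>
     (\<exists>p. pre_digraph.cycle G p \<and> 3 \<le> length p \<and> tail G ` set p = verts G)"

definition hypohamiltonian :: "('a, 'b) pre_digraph \<Rightarrow> bool" where
  "hypohamiltonian G \<longleftrightarrow>
     \<not> hamiltonian G \<and> (\<forall>v \<in> verts G. hamiltonian (G \<restriction> (verts G - {v})))"


section \<open>Closed surfaces\<close>

text \<open>
  A closed surface is presented by finitely many disjoint polygons whose sides are glued in pairs.
  Each polygon comes with a direction of traversal of its boundary: \<open>succ_side d\<close> is the side
  following \<open>d\<close> (polygons with one or two sides are allowed), and a side \<open>d\<close> also stands for
  the corner at which it starts, so \<open>d\<close> runs from the corner \<open>d\<close> to the corner \<open>succ_side d\<close>.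
  The side \<open>d\<close> is glued to the side \<open>glue d\<close>, start to start and end to end if
  \<open>parallel d\<close>, and start to end otherwise. By the triangulation theorem every closed surface
  arises in this way, and every such gluing is a closed surface.
\<close>

record 'd gluing =
  sides :: "'d set"
  succ_side :: "'d \<Rightarrow> 'd"
  glue :: "'d \<Rightarrow> 'd"
  parallel :: "'d \<Rightarrow> bool"

definition closed_surface :: "'d gluing \<Rightarrow> bool" where
  "closed_surface S \<longleftrightarrow>
     finite (sides S) \<and> sides S \<noteq> {} \<and>
     succ_side S permutes sides S \<and>
     (\<forall>d \<in> sides S. glue S d \<in> sides S \<and> glue S d \<noteq> d \<and> glue S (glue S d) = d \<and>
        parallel S (glue S d) = parallel S d) \<and>
     (\<forall>d \<in> sides S. \<forall>e \<in> sides S.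
        (d, e) \<in> ({(a, succ_side S a) | a. a \<in> sides S} \<union> {(a, glue S a) | a. a \<in> sides S})\<^sup>*)"

definition corner_rel :: "'d gluing \<Rightarrow> 'd rel" where
  "corner_rel S =
     {(d, succ_side S (glue S d)) | d. d \<in> sides S \<and> \<not> parallel S d} \<union>
     {(d, glue S d) | d. d \<in> sides S \<and> parallel S d} \<union>
     {(succ_side S d, succ_side S (glue S d)) | d. d \<in> sides S \<and> parallel S d}"

text \<open>
  The point of the surface at the corner \<open>d\<close>, as the set of all corners glued together there.
\<close>

definition vertex_at :: "'d gluing \<Rightarrow> 'd \<Rightarrow> 'd set" where
  "vertex_at S d = (symcl (corner_rel S))\<^sup>* `` {d}"

definition surf_vertices :: "'d gluing \<Rightarrow> 'd set set" where
  "surf_vertices S = vertex_at S ` sides S"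

definition surf_edges :: "'d gluing \<Rightarrow> 'd set set" where
  "surf_edges S = (\<lambda>d. {d, glue S d}) ` sides S"

definition surf_faces :: "'d gluing \<Rightarrow> 'd set set" where
  "surf_faces S = orbit (succ_side S) ` sides S"

definition euler_char :: "'d gluing \<Rightarrow> int" where
  "euler_char S =
     int (card (surf_vertices S)) - int (card (surf_edges S)) + int (card (surf_faces S))"

text \<open>
  An orientation tells for each polygon whether its direction of traversal is to be kept; it is
  coherent if the two copies of each glued side are traversed in opposite directions.
\<close>

definition orientable :: "'d gluing \<Rightarrow> bool" where
  "orientable S \<longleftrightarrow>
     (\<exists>keep :: 'd \<Rightarrow> bool. \<forall>d \<in> sides S. keep (succ_side S d) = keep d \<and>
        (keep (glue S d) = keep d \<longleftrightarrow> \<not> parallel S d))"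


section \<open>Embeddings and genus\<close>

text \<open>
  A graph embedded in a surface is drawn in the 1-skeleton of a presentation of the surface:
  vertices go to distinct points and every edge goes to an edge of the 1-skeleton with the right
  ends. As the graph is simple, distinct edges go to distinct edges. The 1-skeleton may
  have further vertices and edges, so the complement of the drawing need not consist of discs.
\<close>

definition drawn_in :: "('a, 'b) pre_digraph \<Rightarrow> 'd gluing \<Rightarrow> bool" where
  "drawn_in G S \<longleftrightarrow>
     (\<exists>\<phi>. inj_on \<phi> (verts G) \<and> \<phi> ` verts G \<subseteq> surf_vertices S \<and>
        (\<forall>(u, v) \<in> arcs_ends G. \<exists>d \<in> sides S.
           {\<phi> u, \<phi> v} = {vertex_at S d, vertex_at S (succ_side S d)}))"

text \<open>
  By the classification of surfaces, the closed surface with \<open>g\<close> handles is the orientable one of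
  Euler characteristic \<open>2 - 2 g\<close>, and that with \<open>k\<close> crosscaps is the non-orientable
  one of Euler characteristic \<open>2 - k\<close>. Presentations by natural numbers suffice, as they are finite.
\<close>

definition embeds_orientable :: "('a, 'b) pre_digraph \<Rightarrow> nat \<Rightarrow> bool" where
  "embeds_orientable G g \<longleftrightarrow>
     (\<exists>S :: nat gluing. closed_surface S \<and> orientable S \<and> euler_char S = 2 - 2 * int g \<and>
        drawn_in G S)"

definition embeds_nonorientable :: "('a, 'b) pre_digraph \<Rightarrow> nat \<Rightarrow> bool" where
  "embeds_nonorientable G k \<longleftrightarrow>
     (\<exists>S :: nat gluing. closed_surface S \<and> \<not> orientable S \<and> euler_char S = 2 - int k \<and>
        drawn_in G S)"

definition planar :: "('a, 'b) pre_digraph \<Rightarrow> bool" where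
  "planar G \<longleftrightarrow> embeds_orientable G 0"

definition orientable_genus :: "('a, 'b) pre_digraph \<Rightarrow> enat" where
  "orientable_genus G = Inf {enat g | g. embeds_orientable G g}"

definition nonorientable_genus :: "('a, 'b) pre_digraph \<Rightarrow> enat" where
  "nonorientable_genus G = Inf {enat k | k. embeds_nonorientable G k}"


section \<open>The construction\<close>

datatype 'a gadget_vertex =
    Orig 'a
  | VX | VY
  | VR nat | VG nat | VO nat
  | VX' | VY' | VZ'

text \<open>The graph \<open>G\<^sub>i\<close> for \<open>H = H\<^sub>i\<close>, \<open>z = z\<^sub>i\<close>; the neighbours of \<open>z\<close> are \<open>n 1\<close>, \<open>n 2\<close>, \<open>n 3\<close>.\<close>

definition gadget :: "'a pair_pre_digraph \<Rightarrow> 'a \<Rightarrow> (nat \<Rightarrow> 'a) \<Rightarrow> 'a gadget_vertex pair_pre_digraph"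
  where
  "gadget H z n =
     (let Z = Orig z;
          E0 = map_prod Orig Orig ` parcs H;
          E1 = (E0 - symcl {(Z, Orig (n 1)), (Z, Orig (n 2))}) \<union>
               symcl {(Orig (n 1), VX), (VX, Z), (Orig (n 2), VY), (VY, Z), (VX, VY)};
          E2 = (E1 - symcl {(VX, VY), (VY, Z), (Z, VX)}) \<union>
               symcl {(VX, VR 1), (VR 1, VG 1), (VG 1, VY),
                      (VY, VR 2), (VR 2, VG 2), (VG 2, Z),
                      (Z, VR 3), (VR 3, VG 3), (VG 3, VX)};
          E3 = E2 \<union>
               symcl (\<Union>j \<in> {1, 2, 3}. {(VX', VR j), (VY', VO j), (VO j, VG j), (VZ', VO j)})
      in \<lparr> pverts = Orig ` pverts H \<union> {VX, VY, VX', VY', VZ'} \<union>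
                    VR ` {1, 2, 3} \<union> VG ` {1, 2, 3} \<union> VO ` {1, 2, 3},
           parcs = E3 \<rparr>)"

text \<open>
  The graph \<open>G\<close>. \<open>Part i\<close> is the embedding of \<open>G\<^sub>i - z\<^sub>i'\<close> into the disjoint union, and \<open>\<sigma> i\<close>
  is the chosen ordering of its vertices \<open>o\<^sub>1, o\<^sub>2, o\<^sub>3\<close> as \<open>a\<^sub>i, b\<^sub>i, c\<^sub>i\<close>.
\<close>

datatype 'a big_vertex = Part nat "'a gadget_vertex" | Hub

definition big_graph ::
  "(nat \<Rightarrow> 'a pair_pre_digraph) \<Rightarrow> (nat \<Rightarrow> 'a) \<Rightarrow> (nat \<Rightarrow> nat \<Rightarrow> 'a) \<Rightarrow> (nat \<Rightarrow> nat \<Rightarrow> nat)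
     \<Rightarrow> 'a big_vertex pair_pre_digraph" where
  "big_graph H z n \<sigma> =
     (let Gm = (\<lambda>i. let Gi = gadget (H i) (z i) (n i)
                    in with_proj Gi \<restriction> (pverts Gi - {VZ'}));
          a = (\<lambda>i. Part i (VO (\<sigma> i 1)));
          b = (\<lambda>i. Part i (VO (\<sigma> i 2)));
          c = (\<lambda>i. Part i (VO (\<sigma> i 3)))
      in \<lparr> pverts = insert Hub (\<Union>i \<in> {1, 2, 3}. Part i ` verts (Gm i)),
           parcs = (\<Union>i \<in> {1, 2, 3}. map_prod (Part i) (Part i) ` arcs (Gm i)) \<union>
                   symcl {(Hub, a 1), (Hub, a 2), (Hub, a 3),
                          (b 1, c 2), (b 2, c 3), (b 3, c 1)} \<rparr>)"

end

theory Submission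
  imports Defs
begin

text \<open>
  Each \<open>G\<^sub>i - z\<^sub>i'\<close> has the non-planar graph \<open>H\<^sub>i\<close> as a minor, obtained by contracting the path
  \<open>x r\<^sub>1 g\<^sub>1 y r\<^sub>2 g\<^sub>2 z\<close>. So a surface carrying \<open>G\<close> carries three disjoint connected graphs that have
  non-planar minors, and it remains to see that Euler genus \<open>2 - \<chi>\<close> adds up over disjoint graphs.
  Cut down the 1-skeleton of the surface to a set of edges \<open>A\<close>, thicken it to a ribbon graph with
  \<open>k\<close> components, \<open>V\<close> vertices and \<open>F\<close> boundary components, and let its Euler genus be
  \<open>2 k - V + |A| - F\<close>. This is \<open>2 - \<chi>\<close> for the full 1-skeleton, does not decrease when an edge is
  added, and is additive over components. In Euler genus 0 the ribbon graph is orientable, and capping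
  off its boundary after contracting the path yields a sphere on which the minor is drawn. So each of the
  three graphs contributes at least 1, and at least 2 on an orientable surface, where the
  contributions are even.
\<close>


section \<open>Connectivity relations and counting classes\<close>

text \<open>The obstacle is that the regions left by a drawing need not be discs, so counting
  regions says little about a piece of the graph. The boundary components of a ribbon graph can be
  counted for any set of edges, which makes the Euler genus meaningful for every subgraph of the
  1-skeleton. All its properties come from adding one edge, which switches two pairs of a matching
  on flags. The Euler genus grows by 0 if the edge joins two components or splits a boundary
  component, by 1 if it is twisted and starts and ends on one boundary component that stays in one
  piece, and by 2 if it joins two boundary components of one component. This gives monotonicity; on
  an orientable surface the value 1 cannot occur, which gives evenness; and Euler genus 0 leaves
  only the value 0, which allows an orientation to be built edge by edge. Flags are used instead of
  darts because the surface may be non-orientable; an orientation is then a 2-colouring of the flags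
  that all three involutions reverse.\<close>

definition conn :: "('x \<Rightarrow> 'x) set \<Rightarrow> 'x rel" where
  "conn fs = {(x, f x) | x f. f \<in> fs}\<^sup>*"

lemma conn_refl [simp]: "(x, x) \<in> conn fs"
  by (simp add: conn_def)

lemma conn_trans: "(x, y) \<in> conn fs \<Longrightarrow> (y, w) \<in> conn fs \<Longrightarrow> (x, w) \<in> conn fs"
  unfolding conn_def by (rule rtrancl_trans)

lemma conn_step: "f \<in> fs \<Longrightarrow> (x, y) \<in> conn fs \<Longrightarrow> (x, f y) \<in> conn fs"
  unfolding conn_def by (rule rtrancl_into_rtrancl) auto

lemma conn_induct [consumes 1, case_names base step]:
  assumes "(x, y) \<in> conn fs" and "P x"
    and "\<And>f y. f \<in> fs \<Longrightarrow> (x, y) \<in> conn fs \<Longrightarrow> P y \<Longrightarrow> P (f y)"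
  shows "P y"
  using assms(1) unfolding conn_def
proof (induction rule: rtrancl_induct)
  case base
  show ?case by (rule assms(2))
next
  case (step y w)
  then obtain f where f: "f \<in> fs" "w = f y" by blast
  moreover have "(x, y) \<in> conn fs" using step.hyps(1) unfolding conn_def .
  ultimately show ?case using assms(3) step.IH by blast
qed

lemma conn_closed:
  assumes "(x, y) \<in> conn fs" and "x \<in> X" and "\<And>f z. f \<in> fs \<Longrightarrow> z \<in> X \<Longrightarrow> f z \<in> X"
  shows "y \<in> X"
  using assms(1) by (induction rule: conn_induct) (use assms in auto)

lemma equiv_conn_inverses:
  assumes "\<And>f. f \<in> fs \<Longrightarrow> \<exists>g \<in> fs. \<forall>x. g (f x) = x"
  shows "equiv UNIV (conn fs)"
proof (rule equivI)
  have step_back: "(f y, y) \<in> conn fs" if "f \<in> fs" for f y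
  proof -
    obtain g where "g \<in> fs" "g (f y) = y" using assms \<open>f \<in> fs\<close> by blast
    then show ?thesis using conn_step[of g fs "f y" "f y"] by simp
  qed
  have "(y, x) \<in> conn fs" if "(x, y) \<in> conn fs" for x y
    using that
  proof (induction rule: conn_induct)
    case (step f y)
    then show ?case using step_back conn_trans by metis
  qed simp
  then show "sym (conn fs)" by (auto intro: symI)
qed (auto intro: refl_onI transI conn_trans)

lemma equiv_conn:
  assumes "\<And>f x. f \<in> fs \<Longrightarrow> f (f x) = x"
  shows "equiv UNIV (conn fs)"
  using assms by (intro equiv_conn_inverses) blast

lemma conn_least:
  assumes "equiv UNIV r" and "\<And>x f. f \<in> fs \<Longrightarrow> (x, f x) \<in> r"
  shows "conn fs \<subseteq> r"
proof clarify
  fix x y assume "(x, y) \<in> conn fs"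
  then show "(x, y) \<in> r"
  proof (induction rule: conn_induct)
    case base
    show ?case using assms(1) by (auto elim: equivE dest: refl_onD)
  next
    case (step f y)
    then show ?case using assms by (meson equivE transE)
  qed
qed

text \<open>For an equivalence \<open>r\<close> this is the least equivalence above \<open>r\<close>
  that relates \<open>a\<close> and \<open>b\<close>. The closed form suffices because a chain never
  needs to use the new pair more than once.\<close>

definition merge :: "'x rel \<Rightarrow> 'x \<Rightarrow> 'x \<Rightarrow> 'x rel" where
  "merge r a b = {(x, y). (x, y) \<in> r \<or> (x, a) \<in> r \<and> (b, y) \<in> r \<or> (x, b) \<in> r \<and> (a, y) \<in> r}"

lemma equiv_UNIV_D:
  assumes "equiv UNIV r"
  shows "(x, x) \<in> r" "(x, y) \<in> r \<Longrightarrow> (y, x) \<in> r" "(x, y) \<in> r \<Longrightarrow> (y, w) \<in> r \<Longrightarrow> (x, w) \<in> r"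
  using assms by (auto elim!: equivE dest: refl_onD symD transD)

lemma equiv_merge:
  assumes "equiv UNIV r"
  shows "equiv UNIV (merge r a b)"
proof (rule equivI)
  show "refl (merge r a b)"
    using equiv_UNIV_D(1)[OF assms] by (auto simp: merge_def refl_on_def)
  show "sym (merge r a b)"
    using equiv_UNIV_D(2)[OF assms] by (auto simp: merge_def sym_def)
  show "trans (merge r a b)"
  proof (rule transI)
    fix x y w assume xy: "(x, y) \<in> merge r a b" and yw: "(y, w) \<in> merge r a b"
    note S = equiv_UNIV_D(2)[OF assms] and T = equiv_UNIV_D(3)[OF assms]
    from xy consider "(x, y) \<in> r" | "(x, a) \<in> r" "(b, y) \<in> r" | "(x, b) \<in> r" "(a, y) \<in> r"
      by (auto simp: merge_def)
    then show "(x, w) \<in> merge r a b"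
    proof cases
      case 1
      from yw have "(y, w) \<in> r \<or> (y, a) \<in> r \<and> (b, w) \<in> r \<or> (y, b) \<in> r \<and> (a, w) \<in> r"
        by (simp add: merge_def)
      then show ?thesis using T[OF 1] by (auto simp: merge_def)
    next
      case 2
      from yw have "(y, w) \<in> r \<or> (y, a) \<in> r \<and> (b, w) \<in> r \<or> (y, b) \<in> r \<and> (a, w) \<in> r"
        by (simp add: merge_def)
      then show ?thesis using T[OF 2(2)] 2 T[OF 2(1)] by (auto simp: merge_def)
    next
      case 3
      from yw have "(y, w) \<in> r \<or> (y, a) \<in> r \<and> (b, w) \<in> r \<or> (y, b) \<in> r \<and> (a, w) \<in> r"
        by (simp add: merge_def)
      then show ?thesis using T[OF 3(2)] 3 T[OF 3(1)] by (auto simp: merge_def)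
    qed
  qed
qed simp

lemma merge_least:
  assumes "equiv UNIV r'" "r \<subseteq> r'" "(a, b) \<in> r'"
  shows "merge r a b \<subseteq> r'"
proof (rule subrelI)
  fix x y assume "(x, y) \<in> merge r a b"
  then have "(x, y) \<in> r' \<or> (x, a) \<in> r' \<and> (b, y) \<in> r' \<or> (x, b) \<in> r' \<and> (a, y) \<in> r'"
    using assms(2) by (auto simp: merge_def)
  moreover have "(b, a) \<in> r'" using assms equiv_UNIV_D(2) by metis
  ultimately show "(x, y) \<in> r'" using assms(3) equiv_UNIV_D(3)[OF assms(1)] by blast
qed

lemma merge_mono: "equiv UNIV r \<Longrightarrow> r \<subseteq> merge r a b"
  by (auto simp: merge_def)

lemma merge_absorb:
  assumes "equiv UNIV r" "(a, b) \<in> r"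
  shows "merge r a b = r"
  using merge_least[OF assms(1) _ assms(2)] merge_mono[OF assms(1)] by blast

lemma merge_pair:
  assumes "equiv UNIV r"
  shows "(a, b) \<in> merge r a b"
  using equiv_UNIV_D(1)[OF assms] by (simp add: merge_def)

lemma card_quotient_merge:
  assumes r: "equiv UNIV r" and "finite \<Psi>" "a \<in> \<Psi>" "b \<in> \<Psi>"
  shows "card (\<Psi> // r) = card (\<Psi> // merge r a b) + (if (a, b) \<in> r then 0 else 1)"
proof (cases "(a, b) \<in> r")
  case True
  then show ?thesis using merge_absorb[OF r True] by simp
next
  case False
  note E = equiv_UNIV_D[OF r]
  let ?A = "r `` {a}" and ?B = "r `` {b}" and ?R = "\<Psi> // r"
  have neq: "?A \<noteq> ?B" using False eq_equiv_class_iff[OF r] by simp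
  have cls: "merge r a b `` {x} = (if (x, a) \<in> r \<or> (x, b) \<in> r then ?A \<union> ?B else r `` {x})" for x
  proof -
    have "(x, y) \<in> merge r a b \<longleftrightarrow> (if (x, a) \<in> r \<or> (x, b) \<in> r then (a, y) \<in> r \<or> (b, y) \<in> r else (x, y) \<in> r)" for y
    proof -
      have "(x, y) \<in> r \<longleftrightarrow> (a, y) \<in> r" if "(x, a) \<in> r"
        using that E(2,3) by blast
      moreover have "(x, y) \<in> r \<longleftrightarrow> (b, y) \<in> r" if "(x, b) \<in> r"
        using that E(2,3) by blast
      ultimately show ?thesis by (auto simp: merge_def)
    qed
    then show ?thesis by (auto simp: Image_def)
  qed
  have mem: "?A \<in> ?R" "?B \<in> ?R" using assms(3,4) by (auto simp: quotient_def)
  have A: "r `` {x} = ?A \<longleftrightarrow> (x, a) \<in> r" "r `` {x} = ?B \<longleftrightarrow> (x, b) \<in> r" for x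
    using eq_equiv_class_iff[OF r] by simp_all
  \<comment> \<open>The new quotient is the image of the old one under the map that sends the two
    classes to their union and fixes every other class.\<close>
  have eq: "\<Psi> // merge r a b = insert (?A \<union> ?B) (?R - {?A, ?B})"
  proof -
    have "\<Psi> // merge r a b = (\<lambda>x. merge r a b `` {x}) ` \<Psi>" by (auto simp: quotient_def)
    also have "\<dots> = (\<lambda>x. if r `` {x} = ?A \<or> r `` {x} = ?B then ?A \<union> ?B else r `` {x}) ` \<Psi>"
      using cls A by (intro image_cong) auto
    also have "\<dots> = (\<lambda>X. if X = ?A \<or> X = ?B then ?A \<union> ?B else X) ` ?R"
      by (auto simp: quotient_def image_iff)
    also have "\<dots> = insert (?A \<union> ?B) (?R - {?A, ?B})" using mem by auto
    finally show ?thesis .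
  qed
  have "?A \<union> ?B \<notin> ?R - {?A, ?B}"
  proof
    assume "?A \<union> ?B \<in> ?R - {?A, ?B}"
    then obtain x where x: "?A \<union> ?B = r `` {x}" "r `` {x} \<noteq> ?A" by (auto simp: quotient_def)
    then have "(x, a) \<in> r" using E(1) by auto
    then show False using x A by simp
  qed
  moreover have fin: "finite ?R" using \<open>finite \<Psi>\<close> by (simp add: quotient_def)
  moreover have "card {?A, ?B} \<le> card ?R" using mem fin by (intro card_mono) auto
  ultimately have "card (\<Psi> // merge r a b) + 1 = card ?R"
    unfolding eq using mem neq by (simp add: card_Diff_subset)
  with False show ?thesis by simp
qed

lemma card_quotient_labels:
  assumes "\<And>x y. x \<in> \<Psi> \<Longrightarrow> y \<in> \<Psi> \<Longrightarrow> (x, y) \<in> r \<longleftrightarrow> h x = h y" and "equiv UNIV r"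
  shows "card (\<Psi> // r) = card (h ` \<Psi>)"
proof -
  note E = equiv_UNIV_D[OF assms(2)]
  have "bij_betw (\<lambda>x. r `` {inv_into \<Psi> h x}) (h ` \<Psi>) (\<Psi> // r)"
  proof (rule bij_betwI')
    fix x y assume "x \<in> h ` \<Psi>" "y \<in> h ` \<Psi>"
    moreover have "r `` {u} = r `` {v} \<longleftrightarrow> (u, v) \<in> r" for u v
      using eq_equiv_class_iff[OF assms(2)] by simp
    ultimately show "(r `` {inv_into \<Psi> h x} = r `` {inv_into \<Psi> h y}) = (x = y)"
      using assms(1) by (metis inv_into_into f_inv_into_f)
  next
    fix x assume "x \<in> h ` \<Psi>"
    then show "r `` {inv_into \<Psi> h x} \<in> \<Psi> // r" by (simp add: inv_into_into quotientI)
  next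
    fix X assume "X \<in> \<Psi> // r"
    then obtain x where x: "x \<in> \<Psi>" "X = r `` {x}" by (auto elim: quotientE)
    then have "(inv_into \<Psi> h (h x), x) \<in> r"
      using assms(1) by (metis inv_into_into f_inv_into_f imageI)
    then have "X = r `` {inv_into \<Psi> h (h x)}"
      using eq_equiv_class_iff[OF assms(2), of "inv_into \<Psi> h (h x)" x] x by simp
    with x show "\<exists>w\<in>h ` \<Psi>. X = r `` {inv_into \<Psi> h w}" by blast
  qed
  then show ?thesis by (metis bij_betw_same_card)
qed

lemma card_quotient_Un:
  assumes "equiv UNIV r" "finite \<Psi>\<^sub>1" "finite \<Psi>\<^sub>2"
    and "\<And>x y. x \<in> \<Psi>\<^sub>1 \<Longrightarrow> y \<in> \<Psi>\<^sub>2 \<Longrightarrow> (x, y) \<notin> r"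
  shows "card ((\<Psi>\<^sub>1 \<union> \<Psi>\<^sub>2) // r) = card (\<Psi>\<^sub>1 // r) + card (\<Psi>\<^sub>2 // r)"
proof -
  have "(\<Psi>\<^sub>1 \<union> \<Psi>\<^sub>2) // r = \<Psi>\<^sub>1 // r \<union> \<Psi>\<^sub>2 // r" by (auto simp: quotient_def)
  moreover have "\<Psi>\<^sub>1 // r \<inter> \<Psi>\<^sub>2 // r = {}"
  proof (rule ccontr)
    assume "\<Psi>\<^sub>1 // r \<inter> \<Psi>\<^sub>2 // r \<noteq> {}"
    then obtain x y where "x \<in> \<Psi>\<^sub>1" "y \<in> \<Psi>\<^sub>2" "r `` {x} = r `` {y}"
      by (auto simp: quotient_def)
    moreover from this have "(x, y) \<in> r" using equiv_UNIV_D(1)[OF assms(1), of y] by blast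
    ultimately show False using assms(4) by blast
  qed
  ultimately show ?thesis
    using assms(2,3) by (simp add: card_Un_disjoint quotient_def)
qed

lemma card_quotient_cong:
  assumes "\<And>x y. x \<in> \<Psi> \<Longrightarrow> (x, y) \<in> r \<longleftrightarrow> (x, y) \<in> r'"
  shows "card (\<Psi> // r) = card (\<Psi> // r')"
proof -
  have "\<Psi> // r = \<Psi> // r'" unfolding quotient_def using assms by (intro SUP_cong) auto
  then show ?thesis by simp
qed

lemma card_fixpoint_free_involution:
  assumes "finite X" "\<And>x. x \<in> X \<Longrightarrow> h x \<in> X \<and> h x \<noteq> x \<and> h (h x) = x"
  shows "card X = 2 * card ((\<lambda>x. {x, h x}) ` X)"
proof -
  have "card X = card (\<Union> ((\<lambda>x. {x, h x}) ` X))" using assms(2) by (intro arg_cong[of _ _ card]) auto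
  also have "\<dots> = sum card ((\<lambda>x. {x, h x}) ` X)"
  proof (rule card_Union_disjoint)
    show "pairwise disjnt ((\<lambda>x. {x, h x}) ` X)"
    proof (rule pairwiseI)
      fix P Q assume "P \<in> (\<lambda>x. {x, h x}) ` X" "Q \<in> (\<lambda>x. {x, h x}) ` X" "P \<noteq> Q"
      then obtain x y where xy: "P = {x, h x}" "Q = {y, h y}" "x \<in> X" "y \<in> X" by blast
      have hh: "h (h x) = x" "h (h y) = y" using xy assms(2) by auto
      have "x \<noteq> y" using \<open>P \<noteq> Q\<close> xy(1,2) by auto
      moreover have "x \<noteq> h y" using \<open>P \<noteq> Q\<close> xy(1,2) hh by (metis insert_commute)
      moreover have "h x \<noteq> y" using \<open>P \<noteq> Q\<close> xy(1,2) hh by (metis insert_commute)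
      moreover have "h x \<noteq> h y" using \<open>x \<noteq> y\<close> hh by metis
      ultimately show "disjnt P Q" unfolding xy(1,2) by (auto simp: disjnt_def)
    qed
  qed auto
  also have "\<dots> = sum (\<lambda>_. 2) ((\<lambda>x. {x, h x}) ` X)"
    using assms(2) by (intro sum.cong) (auto simp: card_2_iff)
  finally show ?thesis by simp
qed

lemma balanced_card:
  assumes "finite X" "\<And>x. x \<in> X \<Longrightarrow> h x \<in> X \<and> h (h x) = x \<and> c (h x) = (\<not> c x)"
  shows "card {x \<in> X. c x} = card {x \<in> X. \<not> c x}"
  by (rule bij_betw_same_card[of h], rule bij_betwI[of _ _ _ h]) (use assms(2) in auto)

section \<open>Switching two pairs of a matching\<close>

text \<open>Two perfect matchings \<open>M\<close> and \<open>\<sigma>\<close> form alternating cycles. The matching \<open>\<sigma>'\<close> pairs \<open>f, g\<close> and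
  \<open>f', g'\<close> where \<open>\<sigma>\<close> pairs \<open>f, f'\<close> and \<open>g, g'\<close>; this is the effect of adding an edge on the boundary
  of a ribbon graph.\<close>

locale edge_switch =
  fixes M \<sigma> \<sigma>' :: "'x \<Rightarrow> 'x" and \<Psi> :: "'x set" and f f' g g' :: 'x
  assumes M: "\<And>x. M (M x) = x" "\<And>x. M x \<noteq> x"
    and \<sigma>: "\<And>x. \<sigma> (\<sigma> x) = x" "\<And>x. \<sigma> x \<noteq> x"
    and \<sigma>': "\<And>x. \<sigma>' (\<sigma>' x) = x" "\<And>x. \<sigma>' x \<noteq> x"
    and ends: "\<sigma> f = f'" "\<sigma> g = g'" "\<sigma>' f = g" "\<sigma>' f' = g'"
    and agree: "\<And>x. x \<notin> {f, f', g, g'} \<Longrightarrow> \<sigma>' x = \<sigma> x"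
    and dist: "distinct [f, f', g, g']"
    and fin: "finite \<Psi>" and ends_in: "{f, f', g, g'} \<subseteq> \<Psi>"
    and closed: "\<And>x. x \<in> \<Psi> \<Longrightarrow> M x \<in> \<Psi>" "\<And>x. x \<in> \<Psi> \<Longrightarrow> \<sigma> x \<in> \<Psi>"
begin

lemma ends': "\<sigma> f' = f" "\<sigma> g' = g" "\<sigma>' g = f" "\<sigma>' g' = f'"
  using \<sigma>(1)[of f] \<sigma>(1)[of g] \<sigma>'(1)[of f] \<sigma>'(1)[of f'] ends by simp_all

text \<open>The situation is symmetric under exchanging \<open>\<sigma>\<close> with
  \<open>\<sigma>'\<close> and \<open>f'\<close> with \<open>g\<close>, so an inclusion proved for
  one matching is available for the other.\<close>

lemma swap: "edge_switch M \<sigma>' \<sigma> \<Psi> f g f' g'"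
proof
  fix x assume "x \<in> \<Psi>"
  then show "\<sigma>' x \<in> \<Psi>"
  proof (cases "x \<in> {f, f', g, g'}")
    case True
    then show ?thesis using ends(3,4) ends'(3,4) ends_in by auto
  next
    case False
    then show ?thesis using agree closed(2)[OF \<open>x \<in> \<Psi>\<close>] by simp
  qed
next
  show "distinct [f, g, f', g']" "{f, g, f', g'} \<subseteq> \<Psi>" using dist ends_in by auto
  fix x assume "x \<notin> {f, g, f', g'}"
  then show "\<sigma> x = \<sigma>' x" using agree by auto
qed (use M \<sigma> \<sigma>' ends fin closed in auto)

abbreviation "r \<equiv> conn {M, \<sigma>}"
abbreviation "r' \<equiv> conn {M, \<sigma>'}"

lemma equiv_r: "equiv UNIV r" and equiv_r': "equiv UNIV r'"
  by (rule equiv_conn; use M \<sigma> \<sigma>' in auto)+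

lemma conn_le_merge: "r' \<subseteq> merge r f g"
proof (rule conn_least[OF equiv_merge[OF equiv_r]])
  fix x h assume h: "h \<in> {M, \<sigma>'}"
  have step: "(y, M y) \<in> r" "(y, \<sigma> y) \<in> r" for y
    by (auto intro: conn_step)
  consider "h = M" | "h = \<sigma>'" "x \<notin> {f, f', g, g'}" | "h = \<sigma>'" "x \<in> {f, f', g, g'}"
    using h by auto
  then show "(x, h x) \<in> merge r f g"
  proof cases
    case 1
    then show ?thesis using step by (simp add: merge_def)
  next
    case 2
    then show ?thesis using step(2)[of x] agree by (simp add: merge_def)
  next
    case 3
    have "(f, f') \<in> r" "(f', f) \<in> r" "(g, g') \<in> r" "(g', g) \<in> r"
      using step(2)[of f] step(2)[of f'] step(2)[of g] step(2)[of g'] ends ends' by auto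
    then show ?thesis using 3 ends ends' by (auto simp: merge_def)
  qed
qed

text \<open>The two matchings have a common coarsening, obtained from either relation by one merge.
  Comparing both numbers of classes with that of the coarsening gives
  \<open>card_switch\<close>.\<close>

lemma merge_eq: "merge r f g = merge r' f f'"
proof -
  interpret S: edge_switch M \<sigma>' \<sigma> \<Psi> f g f' g' by (rule swap)
  have "(f, f') \<in> r" "(f, g) \<in> r'"
    using conn_step[of \<sigma> "{M, \<sigma>}" f f] conn_step[of \<sigma>' "{M, \<sigma>'}" f f] ends by simp_all
  then have "(f, g) \<in> merge r' f f'" "(f, f') \<in> merge r f g"
    by (simp_all add: merge_def)
  then show ?thesis
    using merge_least[OF equiv_merge[OF equiv_r'] S.conn_le_merge]
      merge_least[OF equiv_merge[OF equiv_r] conn_le_merge] by (intro equalityI)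
qed

lemma card_switch:
  "card (\<Psi> // r') + (if (f, g) \<in> r then 0 else 1) = card (\<Psi> // r) + (if (f, f') \<in> r' then 0 else 1)"
  using card_quotient_merge[OF equiv_r fin, of f g] card_quotient_merge[OF equiv_r' fin, of f f']
    ends_in unfolding merge_eq by simp

lemma conn_switch: "(f, f') \<in> r' \<Longrightarrow> r' = merge r f g"
  using merge_absorb[OF equiv_r'] merge_eq by metis

lemma reach_in:
  assumes "x \<in> \<Psi>" shows "r' `` {x} \<subseteq> \<Psi>" "r `` {x} \<subseteq> \<Psi>"
proof -
  interpret S: edge_switch M \<sigma>' \<sigma> \<Psi> f g f' g' by (rule swap)
  show "r' `` {x} \<subseteq> \<Psi>" "r `` {x} \<subseteq> \<Psi>"
    using assms closed S.closed by (auto elim!: conn_closed)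
qed

lemma class_closed:
  "y \<in> r' `` {x} \<Longrightarrow> M y \<in> r' `` {x}" "y \<in> r' `` {x} \<Longrightarrow> \<sigma>' y \<in> r' `` {x}"
  "y \<in> r `` {x} \<Longrightarrow> M y \<in> r `` {x}" "y \<in> r `` {x} \<Longrightarrow> \<sigma> y \<in> r `` {x}"
  by (auto intro: conn_step)

text \<open>If \<open>f'\<close> is not reached, \<open>M\<close> pairs up the elements reached from \<open>f\<close> in both structures,
  while \<open>\<sigma>\<close> pairs up all of them but \<open>f\<close>.\<close>

lemma joined_if_separate:
  assumes "(f, g) \<notin> r"
  shows "(f, f') \<in> r'"
proof (rule ccontr)
  assume "(f, f') \<notin> r'"
  define X where "X = r `` {f} \<inter> r' `` {f}"
  have "finite X" using reach_in[of f] ends_in fin unfolding X_def by (auto intro: finite_subset)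
  have "g' \<notin> r `` {f}"
  proof
    assume "g' \<in> r `` {f}"
    from class_closed(4)[OF this] show False using assms ends' by simp
  qed
  then have X: "f \<in> X" "f' \<notin> X" "g \<notin> X" "g' \<notin> X"
    using assms \<open>(f, f') \<notin> r'\<close> by (auto simp: X_def)
  have "even (card X)"
  proof -
    have "M x \<in> X \<and> M x \<noteq> x \<and> M (M x) = x" if "x \<in> X" for x
      using that M class_closed unfolding X_def by blast
    from card_fixpoint_free_involution[OF \<open>finite X\<close> this] show ?thesis by simp
  qed
  moreover have "even (card (X - {f}))"
  proof -
    have "\<sigma> x \<in> X - {f} \<and> \<sigma> x \<noteq> x \<and> \<sigma> (\<sigma> x) = x" if "x \<in> X - {f}" for x
    proof -
      have "\<sigma> x = \<sigma>' x" using that X by (intro agree[symmetric]) auto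
      moreover have "\<sigma> x \<noteq> f" using that X ends(1) \<sigma>(1)[of x] by auto
      ultimately show ?thesis
        using that \<sigma>(1)[of x] \<sigma>(2)[of x] class_closed(2)[of x f] class_closed(4)[of x f]
        unfolding X_def by simp
    qed
    from card_fixpoint_free_involution[OF _ this] show ?thesis using \<open>finite X\<close> by simp
  qed
  ultimately show False using \<open>f \<in> X\<close> \<open>finite X\<close>
    by (metis card_Diff_singleton card_gt_0_iff dvd_diffD1 empty_iff even_diff_nat le_eq_less_or_eq less_one not_less odd_one One_nat_def Suc_leI)
qed

text \<open>Otherwise the class of \<open>f\<close> after the switch contains \<open>f\<close> and
  \<open>g\<close> but neither \<open>f'\<close> nor \<open>g'\<close>. There \<open>M\<close>
  balances the two colours, and \<open>\<sigma>\<close> balances them on all elements except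
  \<open>f\<close> and \<open>g\<close>, which share a colour: a surplus of two.\<close>

lemma joined_if_same_colour:
  assumes cM: "\<And>x. x \<in> \<Psi> \<Longrightarrow> c (M x) = (\<not> c x)" and c\<sigma>: "\<And>x. x \<in> \<Psi> \<Longrightarrow> c (\<sigma> x) = (\<not> c x)"
    and "c f = c g"
  shows "(f, f') \<in> r'"
proof (rule ccontr)
  assume "(f, f') \<notin> r'"
  define X where "X = r' `` {f}"
  have sub: "X \<subseteq> \<Psi>" using reach_in[of f] ends_in unfolding X_def by auto
  then have "finite X" using fin by (rule finite_subset)
  have "f' \<notin> X" using \<open>(f, f') \<notin> r'\<close> by (simp add: X_def)
  moreover have "g' \<notin> X"
  proof
    assume "g' \<in> X"
    from class_closed(2)[OF this[unfolded X_def]] show False using \<open>f' \<notin> X\<close> ends' by (simp add: X_def)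
  qed
  moreover have "f \<in> X" "g \<in> X" using class_closed(2)[of f f] ends by (auto simp: X_def)
  ultimately have X: "f' \<notin> X" "g' \<notin> X" "f \<in> X" "g \<in> X" by auto
  have "card {x \<in> X. c x} = card {x \<in> X. \<not> c x}"
    by (rule balanced_card[OF \<open>finite X\<close>, of M]) (use sub M cM class_closed(1) in \<open>auto simp: X_def\<close>)
  moreover have "card {x \<in> X - {f, g}. c x} = card {x \<in> X - {f, g}. \<not> c x}"
  proof (rule balanced_card[of _ \<sigma>])
    fix x assume x: "x \<in> X - {f, g}"
    then have "\<sigma> x = \<sigma>' x" using X by (intro agree[symmetric]) auto
    moreover have "\<sigma> x \<noteq> f" "\<sigma> x \<noteq> g" using x X ends \<sigma> by (metis DiffE)+
    moreover have "\<sigma>' x \<in> X" using x class_closed(2)[of x f] by (simp add: X_def)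
    moreover have "x \<in> \<Psi>" using x sub by blast
    ultimately show "\<sigma> x \<in> X - {f, g} \<and> \<sigma> (\<sigma> x) = x \<and> c (\<sigma> x) = (\<not> c x)"
      using \<sigma>(1)[of x] c\<sigma>[of x] by simp
  qed (use \<open>finite X\<close> in simp)
  moreover have "{x \<in> X. P x} = {x \<in> X - {f, g}. P x} \<union> (if P f then {f, g} else {})"
    if "P f = P g" for P using X that by (cases "P f") auto
  from this[of c] this[of "Not \<circ> c"] \<open>c f = c g\<close>
  have "{x \<in> X. c x} = {x \<in> X - {f, g}. c x} \<union> (if c f then {f, g} else {})"
    "{x \<in> X. \<not> c x} = {x \<in> X - {f, g}. \<not> c x} \<union> (if c f then {} else {f, g})" by auto
  moreover have "card (Y \<union> {f, g}) = card Y + 2" if "finite Y" "Y \<subseteq> X - {f, g}" for Y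
  proof -
    have "card (Y \<union> {f, g}) = card Y + card {f, g}"
      by (rule card_Un_disjoint) (use that in auto)
    then show ?thesis using dist by simp
  qed
  from this[of "{x \<in> X - {f, g}. c x}"] this[of "{x \<in> X - {f, g}. \<not> c x}"] \<open>finite X\<close>
  have "card ({x \<in> X - {f, g}. c x} \<union> {f, g}) = card {x \<in> X - {f, g}. c x} + 2"
    "card ({x \<in> X - {f, g}. \<not> c x} \<union> {f, g}) = card {x \<in> X - {f, g}. \<not> c x} + 2" by auto
  ultimately show False by (cases "c f") simp_all
qed

text \<open>In the coloured case \<open>M \<circ> \<sigma>\<close> permutes the elements of each colour, and the switch composes it
  with the transposition of \<open>f\<close> and \<open>g'\<close>.\<close>

lemma split_if_coloured:
  assumes cM: "\<And>x. x \<in> \<Psi> \<Longrightarrow> c (M x) = (\<not> c x)" and c\<sigma>: "\<And>x. x \<in> \<Psi> \<Longrightarrow> c (\<sigma> x) = (\<not> c x)"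
    and c\<sigma>': "\<And>x. x \<in> \<Psi> \<Longrightarrow> c (\<sigma>' x) = (\<not> c x)" and "(f, g) \<in> r"
  shows "(f, f') \<notin> r'"
proof -
  interpret S: edge_switch M \<sigma>' \<sigma> \<Psi> f g f' g' by (rule swap)
  define p where "p = (\<lambda>n. ((M \<circ> \<sigma>) ^^ n) f)"
  have p0: "p 0 = f" and pS: "p (Suc n) = M (\<sigma> (p n))" for n by (simp_all add: p_def)
  have p_in: "p n \<in> \<Psi>" for n by (induction n) (use p0 pS ends_in closed in auto)
  have cp: "c (p n) = c f" for n by (induction n) (use p0 pS cM c\<sigma> p_in closed in auto)
  have ce: "c f' = (\<not> c f)" "c g = (\<not> c f)" "c g' = c f"
    using c\<sigma>[of f] c\<sigma>'[of f] c\<sigma>[of g] ends ends_in by auto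
  have Mp: "M (p (Suc n)) = \<sigma> (p n)" for n using pS M by simp
  have inj: "p m = p n \<Longrightarrow> p (m + k) = p (n + k)" for m n k
    by (induction k) (simp_all add: pS)
  have pred: "p (Suc m) = p (Suc n) \<Longrightarrow> p m = p n" for m n
    using pS M \<sigma> by metis
  have pred': "p (m + k) = p k \<Longrightarrow> p m = f" for m k
  proof (induction k)
    case (Suc k)
    then show ?case using pred[of "m + k" k] by simp
  qed (simp add: p0)
  obtain per where per: "per > 0" "p per = f"
  proof -
    have "\<not> inj p" using p_in fin by (metis finite_subset image_subsetI infinite_UNIV_nat range_inj_infinite)
    then obtain m n where "p m = p n" "m < n" by (metis injI nat_neq_iff)
    then show thesis using that[of "n - m"] pred'[of "n - m" m] by simp
  qed
  \<comment> \<open>Every element reached from \<open>f\<close> is some \<open>p n\<close> or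
    \<open>M (p n)\<close>, and these two kinds differ in colour; \<open>g'\<close> has the colour
    of \<open>f\<close>.\<close>
  have "g' \<in> range p"
  proof -
    have "g' \<in> range p \<union> M ` range p"
    proof (rule conn_closed)
      show "(f, g') \<in> r" using conn_step[OF _ \<open>(f, g) \<in> r\<close>, of \<sigma>] ends by simp
      show "f \<in> range p \<union> M ` range p" using p0 by (metis UnI1 rangeI)
      fix h y assume "h \<in> {M, \<sigma>}" and y: "y \<in> range p \<union> M ` range p"
      then consider "h = M" | "h = \<sigma>" by auto
      then show "h y \<in> range p \<union> M ` range p"
      proof cases
        case 1
        then show ?thesis using y M by auto
      next
        case 2
        from y consider n where "y = p n" | n where "y = M (p n)" by blast
        then show ?thesis
        proof cases
          case 1
          then have "h y = M (p (Suc n))" using Mp[of n] 2 by simp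
          then show ?thesis by simp
        next
          case (2 n)
          obtain m where "p n = p (Suc m)"
          proof (cases n)
            case 0
            then show ?thesis using that[of "per - 1"] per p0 by simp
          qed (use that in auto)
          then have "\<sigma> y = p m" using 2 Mp \<sigma> by metis
          then show ?thesis using \<open>h = \<sigma>\<close> by simp
        qed
      qed
    qed
    moreover have "g' \<notin> M ` range p" using cM cp p_in ce by auto
    ultimately show ?thesis by blast
  qed
  then have "\<exists>n. p n = g'" by auto
  define j where "j = (LEAST n. p n = g')"
  have pj: "p j = g'" using \<open>\<exists>n. p n = g'\<close> unfolding j_def by (rule LeastI_ex)
  have least: "p i \<noteq> g'" if "i < j" for i using that not_less_Least unfolding j_def by blast
  have "j > 0" using pj p0 dist by (intro gr0I) auto
  \<comment> \<open>The switch cuts the cycle through \<open>f\<close> at \<open>g'\<close>: after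
    it, \<open>g'\<close> is followed by \<open>M (\<sigma>' g') = M f' = p 1\<close>. So
    \<open>p 1\<close>, ..., \<open>p j\<close> close up to a cycle that contains \<open>g'\<close>
    but not \<open>f\<close>.\<close>
  define Y where "Y = p ` {1..j}"
  have pY: "p i \<in> Y" if "1 \<le> i" "i \<le> j" for i using that by (auto simp: Y_def)
  have notf: "p i \<noteq> f" if "1 \<le> i" "i \<le> j" for i
  proof
    assume "p i = f"
    then have "p (i + (j - i)) = p (0 + (j - i))" by (intro inj) (simp add: p0)
    then have "p (j - i) = g'" using that pj by simp
    then show False using least[of "j - i"] that by simp
  qed
  have "f \<notin> Y \<union> M ` Y"
  proof -
    have "c (M (p i)) \<noteq> c f" for i using cM[OF p_in] cp by simp
    then show ?thesis using notf unfolding Y_def by (fastforce simp: image_iff)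
  qed
  moreover have closedY: "h y \<in> Y \<union> M ` Y" if hM: "h \<in> {M, \<sigma>'}" and yY: "y \<in> Y \<union> M ` Y" for h y
  proof -
    have eq: "\<sigma>' (p i) = \<sigma> (p i)" if "p i \<noteq> f" "p i \<noteq> g'" for i
    proof (rule agree)
      have "p i \<noteq> f'" "p i \<noteq> g" using cp[of i] ce by auto
      then show "p i \<notin> {f, f', g, g'}" using that by auto
    qed
    consider "h = M" | i where "h = \<sigma>'" "y = p i" "1 \<le> i" "i \<le> j"
      | i where "h = \<sigma>'" "y = M (p i)" "1 \<le> i" "i \<le> j"
      using hM yY unfolding Y_def by auto
    then show ?thesis
    proof cases
      case 1
      then show ?thesis using yY M by auto
    next
      case (2 i)
      show ?thesis
      proof (cases "i = j")
        case True
        have "\<sigma>' y = M (p 1)" using 2 True pj ends' Mp[of 0] p0 ends by simp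
        then show ?thesis using 2 pY[of 1] \<open>j > 0\<close> by auto
      next
        case False
        then have "\<sigma>' y = M (p (Suc i))" using 2 eq notf least Mp by simp
        then show ?thesis using 2 False pY[of "Suc i"] by auto
      qed
    next
      case (3 i)
      then obtain k where k: "i = Suc k" by (cases i) auto
      show ?thesis
      proof (cases "k = 0")
        case True
        have "\<sigma>' y = p j" using 3 k True Mp[of 0] p0 ends ends' pj by simp
        then show ?thesis using 3 pY[of j] \<open>j > 0\<close> by auto
      next
        case False
        have ne: "p k \<noteq> f" "p k \<noteq> g'" using False k 3 notf[of k] least[of k] by auto
        have "\<sigma> (p k) \<notin> {f, f', g, g'}"
          using ne \<sigma> ends ends' cp[of k] ce by (metis insertE singletonD)
        then have "\<sigma>' y = p k" using 3 k Mp agree \<sigma> by simp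
        then show ?thesis using 3 k False pY[of k] by auto
      qed
    qed
  qed
  ultimately have "(g', f) \<notin> r'"
    using conn_closed[of g' f "{M, \<sigma>'}" "Y \<union> M ` Y"] pY[of j] \<open>j > 0\<close> pj by auto
  moreover have "(f', g') \<in> r'" using conn_step[of \<sigma>' "{M, \<sigma>'}" f' f'] ends by simp
  ultimately show ?thesis using equiv_UNIV_D(2,3)[OF equiv_r'] by metis
qed

end

section \<open>Ribbon graphs and their Euler genus\<close>

lemma bipartite_involutions:
  fixes s t :: "'x \<Rightarrow> 'x"
  assumes s: "\<And>x. s (s x) = x" "\<And>x. s x \<noteq> x" and t: "\<And>x. t (t x) = x" "\<And>x. t x \<noteq> x"
  shows "\<exists>c. \<forall>x. c (s x) = (\<not> c x) \<and> c (t x) = (\<not> c x)"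
proof -
  define p where "p = s \<circ> t"
  define q where "q = t \<circ> s"
  have pq: "p (q x) = x" "q (p x) = x" for x using s t by (simp_all add: p_def q_def)
  define E where "E = conn {p, q}"
  have E: "equiv UNIV E" unfolding E_def by (rule equiv_conn_inverses) (use pq in auto)
  note Ed = equiv_UNIV_D[OF E]
  have Estep: "(x, y) \<in> E \<Longrightarrow> (x, p y) \<in> E" "(x, y) \<in> E \<Longrightarrow> (x, q y) \<in> E" for x y
    unfolding E_def by (auto intro: conn_step)
  \<comment> \<open>Descent by two: if \<open>p ^^ n\<close> sends \<open>x\<close> to its image
    under \<open>s\<close> or \<open>t\<close>, then \<open>p ^^ (n - 2)\<close> does so with
    \<open>p x\<close>. The cases 0 and 1 would give a fixed point of \<open>s\<close> or
    \<open>t\<close>.\<close>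
  have noref: "(p ^^ n) x \<noteq> s x \<and> (p ^^ n) x \<noteq> t x" for n x
  proof (induction n arbitrary: x rule: less_induct)
    case (less n)
    consider "n = 0" | "n = 1" | m where "n = Suc (Suc m)"
      by (metis One_nat_def not0_implies_Suc)
    then show ?case
    proof cases
      case 1
      then show ?thesis using s(2)[of x] t(2)[of x] by auto
    next
      case 2
      have "s (t x) \<noteq> s x" using s(1) t(2) by metis
      then show ?thesis using 2 s(2)[of "t x"] by (simp add: p_def)
    next
      case (3 m)
      have eq: "p (p ((p ^^ m) x)) = (p ^^ n) x" using 3 by simp
      have sh: "p ((p ^^ m) y) = (p ^^ m) (p y)" for y by (simp add: funpow_swap1)
      show ?thesis
      proof (intro conjI notI)
        assume a: "(p ^^ n) x = s x"
        have "(p ^^ n) x = (p ^^ m) (p (p x))" using eq sh by simp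
        then have "p ((p ^^ m) (p x)) = s x" using a sh by simp
        then have "s (t ((p ^^ m) (p x))) = s x" by (simp add: p_def)
        then have "t ((p ^^ m) (p x)) = x" using s(1) by metis
        then have "(p ^^ m) (p x) = t x" using t(1) by metis
        moreover have "t x = s (p x)" using s(1) by (simp add: p_def)
        ultimately show False using less.IH[of m "p x"] 3 by auto
      next
        assume a: "(p ^^ n) x = t x"
        have "(p ^^ n) x = (p ^^ m) (p (p x))" using eq sh by simp
        then have "p ((p ^^ m) (p x)) = t x" using a sh by simp
        then have "(p ^^ m) (p x) = q (t x)" using pq by metis
        moreover have "q (t x) = t (p x)" by (simp add: p_def q_def)
        ultimately show False using less.IH[of m "p x"] 3 by auto
      qed
    qed
  qed
  have En: "\<exists>n. (p ^^ n) x = y \<or> (p ^^ n) y = x" if "(x, y) \<in> E" for x y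
    using that unfolding E_def
  proof (induction rule: conn_induct)
    case base
    show ?case by (rule exI[of _ 0]) simp
  next
    case (step f y)
    then obtain n where n: "(p ^^ n) x = y \<or> (p ^^ n) y = x" by blast
    have pn: "(p ^^ Suc k) z = (p ^^ k) (p z)" for k z by (simp add: funpow_swap1)
    from n consider "(p ^^ n) x = y" | m where "n = Suc m" "(p ^^ n) y = x" | "y = x"
      by (cases n) auto
    then show ?case
    proof cases
      case 1
      show ?thesis
      proof (cases "f = p")
        case True
        then show ?thesis using 1 by (intro exI[of _ "Suc n"]) simp
      next
        case False
        then have f: "f = q" using step.hyps by simp
        show ?thesis
        proof (cases n)
          case 0
          then show ?thesis using 1 f pq by (intro exI[of _ 1]) simp
        next
          case (Suc m)
          then have "p ((p ^^ m) x) = y" using 1 by simp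
          then have "(p ^^ m) x = q y" using pq by metis
          then show ?thesis using f by blast
        qed
      qed
    next
      case (2 m)
      show ?thesis
      proof (cases "f = p")
        case True
        have "(p ^^ m) (p y) = x" using 2 pn by metis
        then show ?thesis using True by blast
      next
        case False
        then have f: "f = q" using step.hyps by simp
        have "(p ^^ Suc n) (q y) = x" using 2 pq pn by metis
        then show ?thesis using f by blast
      qed
    next
      case 3
      show ?thesis
      proof (cases "f = p")
        case True
        then show ?thesis using 3 by (intro exI[of _ 1]) simp
      next
        case False
        then show ?thesis using step.hyps 3 pq by (intro exI[of _ 1]) auto
      qed
    qed
  qed
  have sE: "(x, s x) \<notin> E" and tE: "(x, t x) \<notin> E" for x
    using En[of x "s x"] En[of x "t x"] noref[of _ x] noref[of _ "s x"] noref[of _ "t x"] s t by metis+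
  define R where "R = conn {s, t}"
  have R: "equiv UNIV R" unfolding R_def by (rule equiv_conn) (use s t in auto)
  \<comment> \<open>The colour of a point will tell whether it lies in the rotation orbit of the
    chosen representative of its component.\<close>
  define \<rho> where "\<rho> x = (SOME y. (y, x) \<in> R)" for x
  have \<rho>R: "(\<rho> x, x) \<in> R" for x
    unfolding \<rho>_def by (rule someI[of _ x]) (rule equiv_UNIV_D(1)[OF R])
  have \<rho>_eq: "\<rho> x = \<rho> y" if "(x, y) \<in> R" for x y
  proof -
    have "(\<lambda>w. (w, x) \<in> R) = (\<lambda>w. (w, y) \<in> R)"
      using equiv_UNIV_D(2,3)[OF R] that by blast
    then show ?thesis by (simp add: \<rho>_def)
  qed
  have st: "(u, s y) \<in> E \<longleftrightarrow> (u, t y) \<in> E" for u y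
  proof -
    have "s y = p (t y)" "t y = q (s y)" using s t by (simp_all add: p_def q_def)
    then show ?thesis using Estep by metis
  qed
  have cover: "(u, x) \<in> E \<or> (u, s x) \<in> E" if "(u, x) \<in> R" for u x
    using that unfolding R_def
  proof (induction rule: conn_induct)
    case base
    show ?case using Ed(1) by blast
  next
    case (step f y)
    show ?case
    proof (cases "f = s")
      case True
      then show ?thesis using step.IH s by auto
    next
      case False
      then have f: "f = t" using step.hyps by simp
      from step.IH show ?thesis
      proof
        assume "(u, y) \<in> E"
        from Estep(1)[OF this] show ?thesis using f by (simp add: p_def)
      next
        assume "(u, s y) \<in> E"
        then show ?thesis using f st by simp
      qed
    qed
  qed
  define c where "c x = ((\<rho> x, x) \<in> E)" for x
  have "(x, s x) \<in> R" "(x, t x) \<in> R" for x unfolding R_def by (auto intro: conn_step)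
  then have \<rho>st: "\<rho> (s x) = \<rho> x" "\<rho> (t x) = \<rho> x" for x using \<rho>_eq by metis+
  have "c (s x) = (\<not> c x)" for x
    using cover[OF \<rho>R[of x]] sE[of x] Ed(2,3) \<rho>st unfolding c_def by metis
  moreover have "c (t x) = (\<not> c x)" for x
    using cover[OF \<rho>R[of x]] tE[of x] Ed(2,3) \<rho>st st unfolding c_def by metis
  ultimately show ?thesis by blast
qed

text \<open>One step of a boundary walk of the ribbon graph with edge set \<open>A\<close>: a
  present edge is followed to its other end, an absent one is passed at its foot by crossing to its
  other side.\<close>

definition twist :: "('x \<Rightarrow> 'x) \<Rightarrow> ('x \<Rightarrow> 'x) \<Rightarrow> 'x set \<Rightarrow> 'x \<Rightarrow> 'x" where
  "twist t0 t2 A x = (if x \<in> A then t0 x else t2 x)"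

text \<open>The elements of \<open>\<Psi>\<close> are flags: \<open>t0\<close> moves a flag to the other end of its edge, \<open>t1\<close> to the
  neighbouring edge in the same face and \<open>t2\<close> to the other side of its edge. An edge is a set of four
  flags; edges outside \<open>A0\<close> may have ends outside \<open>\<Psi>\<close>.\<close>

locale ribbon =
  fixes t0 t1 t2 :: "'x \<Rightarrow> 'x" and \<Psi> A0 :: "'x set"
  assumes t0: "\<And>x. t0 (t0 x) = x" "\<And>x. t0 x \<noteq> x"
    and t1: "\<And>x. t1 (t1 x) = x" "\<And>x. t1 x \<noteq> x"
    and t2: "\<And>x. t2 (t2 x) = x" "\<And>x. t2 x \<noteq> x"
    and comm: "\<And>x. t0 (t2 x) = t2 (t0 x)"
    and t02: "\<And>x. x \<in> A0 \<Longrightarrow> t0 x \<noteq> t2 x"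
    and fin: "finite \<Psi>" and A0: "A0 \<subseteq> \<Psi>"
    and \<Psi>: "\<And>x. x \<in> \<Psi> \<Longrightarrow> t1 x \<in> \<Psi>" "\<And>x. x \<in> \<Psi> \<Longrightarrow> t2 x \<in> \<Psi>"
    and A0_closed: "\<And>x. x \<in> A0 \<Longrightarrow> t0 x \<in> A0" "\<And>x. x \<in> A0 \<Longrightarrow> t2 x \<in> A0"
begin

definition edges :: "'x set \<Rightarrow> bool" where
  "edges A \<longleftrightarrow> A \<subseteq> A0 \<and> (\<forall>x \<in> A. t0 x \<in> A \<and> t2 x \<in> A)"

abbreviation tw :: "'x set \<Rightarrow> 'x \<Rightarrow> 'x" where "tw \<equiv> twist t0 t2"

text \<open>The classes of \<open>bd A\<close> are the boundary components of the ribbon graph with edge set \<open>A\<close> and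
  all vertices, those of \<open>cc A\<close> its connected components; \<open>bd {}\<close> has one class for each vertex.\<close>

definition bd :: "'x set \<Rightarrow> 'x rel" where "bd A = conn {t1, tw A}"

definition cc :: "'x set \<Rightarrow> 'x rel" where "cc A = conn {t1, t2, \<lambda>x. if x \<in> A then t0 x else x}"

text \<open>An edge consists of four flags, hence the \<open>div 4\<close>. The factor 2 makes a
  vertex without edges contribute \<open>2 - 1 - 1 = 0\<close>.\<close>

definition eg :: "'x set \<Rightarrow> int" where
  "eg A = 2 * int (card (\<Psi> // cc A)) - int (card (\<Psi> // bd {})) + int (card A div 4)
     - int (card (\<Psi> // bd A))"

definition quad :: "'x \<Rightarrow> 'x set" where "quad e = {e, t2 e, t0 e, t0 (t2 e)}"

lemma tw_invol:
  assumes "edges A"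
  shows "tw A (tw A x) = x" "tw A x \<noteq> x"
proof -
  have "t2 x \<in> A \<longleftrightarrow> x \<in> A" "t0 x \<in> A \<longleftrightarrow> x \<in> A"
    using assms t0 t2 unfolding edges_def by metis+
  then show "tw A (tw A x) = x" "tw A x \<noteq> x" using t0 t2 by (auto simp: twist_def)
qed

lemma tw_in: "edges A \<Longrightarrow> x \<in> \<Psi> \<Longrightarrow> tw A x \<in> \<Psi>"
  using \<Psi> A0 by (auto simp: twist_def edges_def)

lemma equiv_bd: "edges A \<Longrightarrow> equiv UNIV (bd A)"
  unfolding bd_def by (rule equiv_conn) (use t1 tw_invol in auto)

lemma equiv_cc: "edges A \<Longrightarrow> equiv UNIV (cc A)"
  unfolding cc_def by (rule equiv_conn) (use t1 t2 t0 in \<open>auto simp: edges_def\<close>)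

lemma edges_empty: "edges {}" by (simp add: edges_def)

lemma edges_quad:
  assumes "edges A" "e \<in> A0"
  shows "edges (A \<union> quad e)"
  using assms A0_closed t0 t2 unfolding edges_def quad_def by (auto simp: comm)

lemma quad_disjoint:
  assumes "edges A" "e \<notin> A"
  shows "A \<inter> quad e = {}"
proof -
  have "t2 x \<in> A \<longleftrightarrow> x \<in> A" "t0 x \<in> A \<longleftrightarrow> x \<in> A" for x
    using assms(1) t0 t2 unfolding edges_def by metis+
  then show ?thesis using assms(2) by (auto simp: quad_def)
qed

lemma quad_distinct:
  assumes "e \<in> A0"
  shows "distinct [e, t2 e, t0 e, t2 (t0 e)]"
proof -
  have "t2 e \<noteq> t2 (t0 e)" using t0 t2 by metis
  moreover have "e \<noteq> t2 (t0 e)" using t02[OF assms] t2 by metis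
  ultimately show ?thesis using t02[OF assms] t0(2)[of e] t2(2)[of e] t2(2)[of "t0 e"] by auto
qed

lemma card_quad: "e \<in> A0 \<Longrightarrow> card (quad e) = 4"
  using distinct_card[OF quad_distinct[of e]] by (simp add: quad_def comm insert_commute)

lemma finite_edges: "edges A \<Longrightarrow> finite A"
  using fin A0 unfolding edges_def by (meson finite_subset)

lemma card_Un_quad:
  assumes "edges A" "e \<in> A0" "e \<notin> A"
  shows "card (A \<union> quad e) = card A + 4"
  using card_Un_disjoint[OF finite_edges[OF assms(1)] _ quad_disjoint[OF assms(1,3)]] card_quad[OF assms(2)]
  by (simp add: quad_def)

text \<open>The four flags of an absent edge are matched by \<open>t2\<close>, those of a present
  one by \<open>t0\<close>; no other pair changes. This reduces all questions about boundary
  components to \<open>edge_switch\<close>.\<close>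

lemma switch:
  assumes "edges A" "e \<in> A0" "e \<notin> A"
  shows "edge_switch t1 (tw A) (tw (A \<union> quad e)) \<Psi> e (t2 e) (t0 e) (t2 (t0 e))"
proof
  note Q = quad_disjoint[OF assms(1,3)]
  have nA: "x \<notin> A" if "x \<in> quad e" for x using Q that by blast
  show "tw A e = t2 e" "tw A (t0 e) = t2 (t0 e)"
    using nA by (auto simp: twist_def quad_def)
  show "tw (A \<union> quad e) e = t0 e" "tw (A \<union> quad e) (t2 e) = t2 (t0 e)"
    by (auto simp: twist_def quad_def comm)
  show "tw (A \<union> quad e) x = tw A x" if "x \<notin> {e, t2 e, t0 e, t2 (t0 e)}" for x
    using that by (auto simp: twist_def quad_def comm)
  show "{e, t2 e, t0 e, t2 (t0 e)} \<subseteq> \<Psi>" using assms(2) A0 A0_closed \<Psi> by auto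
qed (use t1 tw_invol[OF assms(1)] tw_invol[OF edges_quad[OF assms(1,2)]] quad_distinct[OF assms(2)]
    fin \<Psi> tw_in[OF assms(1)] in auto)

section \<open>Change of the Euler genus when one edge is added\<close>

lemma cc_step: "(y, t1 y) \<in> cc A" "(y, t2 y) \<in> cc A" "y \<in> A \<Longrightarrow> (y, t0 y) \<in> cc A"
  using conn_step[of "\<lambda>x. if x \<in> A then t0 x else x" _ y y] conn_step[of t1 _ y y] conn_step[of t2 _ y y]
  unfolding cc_def by simp_all

lemma bd_step: "(y, t1 y) \<in> bd A" "(y, tw A y) \<in> bd A"
  using conn_step[of t1 _ y y] conn_step[of "tw A" _ y y] unfolding bd_def by simp_all

lemma cc_quad:
  assumes "edges A" "e \<in> A0"
  shows "cc (A \<union> quad e) = merge (cc A) e (t0 e)"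
proof
  have eq: "equiv UNIV (cc A)" "equiv UNIV (cc (A \<union> quad e))"
    using equiv_cc edges_quad assms by auto
  note m = merge_mono[OF eq(1), of e "t0 e"]
  note step = cc_step
  have M: "equiv UNIV (merge (cc A) e (t0 e))" by (rule equiv_merge[OF eq(1)])
  show "cc (A \<union> quad e) \<subseteq> merge (cc A) e (t0 e)"
    unfolding cc_def[of "A \<union> quad e"]
  proof (rule conn_least[OF M])
    fix x h assume h: "h \<in> {t1, t2, \<lambda>x. if x \<in> A \<union> quad e then t0 x else x}"
    have "(x, t0 x) \<in> merge (cc A) e (t0 e)" if "x \<in> quad e"
    proof -
      have e: "(e, t0 e) \<in> merge (cc A) e (t0 e)" by (rule merge_pair[OF eq(1)])
      have s: "(x, t2 x) \<in> merge (cc A) e (t0 e)" for x using step(2)[of x A] m by blast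
      have "(t2 e, t2 (t0 e)) \<in> merge (cc A) e (t0 e)"
        using equiv_UNIV_D(3)[OF M equiv_UNIV_D(3)[OF M equiv_UNIV_D(2)[OF M s] e] s] .
      then show ?thesis
        using that e equiv_UNIV_D(2)[OF M] t0 by (auto simp: quad_def comm)
    qed
    moreover have "(x, t1 x) \<in> merge (cc A) e (t0 e)" "(x, t2 x) \<in> merge (cc A) e (t0 e)"
      "x \<in> A \<Longrightarrow> (x, t0 x) \<in> merge (cc A) e (t0 e)"
      using step m by blast+
    ultimately show "(x, h x) \<in> merge (cc A) e (t0 e)"
      using h equiv_UNIV_D(1)[OF M] by auto
  qed
  show "merge (cc A) e (t0 e) \<subseteq> cc (A \<union> quad e)"
  proof (rule merge_least[OF eq(2)])
    show "cc A \<subseteq> cc (A \<union> quad e)"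
      unfolding cc_def[of A]
      by (rule conn_least[OF eq(2)]) (use cc_step[where A = "A \<union> quad e"] equiv_UNIV_D(1)[OF eq(2)] in \<open>auto split: if_splits\<close>)
    show "(e, t0 e) \<in> cc (A \<union> quad e)" by (rule step) (simp add: quad_def)
  qed
qed

lemma bd_le_cc: "edges A \<Longrightarrow> bd A \<subseteq> cc A"
proof -
  assume A: "edges A"
  show ?thesis unfolding bd_def
  proof (rule conn_least[OF equiv_cc[OF A]])
    fix x h assume "h \<in> {t1, tw A}"
    then show "(x, h x) \<in> cc A"
      using cc_step[of x A] by (auto simp: twist_def)
  qed
qed

text \<open>The last three terms record whether the edge joins two components, whether it meets two
  boundary components, and whether its two sides end on different ones. An edge between two
  components also meets two boundary components, and by \<open>joined_if_separate\<close> these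
  become one; the terms then cancel as \<open>1 - 2 + 1\<close>. So only the increments 0, 1 and 2
  survive.\<close>

lemma eg_step:
  assumes "edges A" "e \<in> A0" "e \<notin> A"
  shows "eg (A \<union> quad e) = eg A + 1 - (if (e, t0 e) \<in> cc A then 0 else 2)
    + (if (e, t0 e) \<in> bd A then 0 else 1) - (if (e, t2 e) \<in> bd (A \<union> quad e) then 0 else 1)"
proof -
  interpret S: edge_switch t1 "tw A" "tw (A \<union> quad e)" \<Psi> e "t2 e" "t0 e" "t2 (t0 e)"
    by (rule switch[OF assms])
  have "card (\<Psi> // bd (A \<union> quad e)) + (if (e, t0 e) \<in> bd A then 0 else 1)
      = card (\<Psi> // bd A) + (if (e, t2 e) \<in> bd (A \<union> quad e) then 0 else 1)"
    using S.card_switch unfolding bd_def .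
  moreover have "card (\<Psi> // cc A) = card (\<Psi> // cc (A \<union> quad e)) + (if (e, t0 e) \<in> cc A then 0 else 1)"
    unfolding cc_quad[OF assms(1,2)]
    by (rule card_quotient_merge[OF equiv_cc[OF assms(1)] fin]) (use assms A0 A0_closed in auto)
  ultimately show ?thesis using card_Un_quad[OF assms] unfolding eg_def
    by (cases "(e, t0 e) \<in> cc A"; cases "(e, t0 e) \<in> bd A"; cases "(e, t2 e) \<in> bd (A \<union> quad e)") simp_all
qed

lemma joined_if_separate:
  assumes "edges A" "e \<in> A0" "e \<notin> A" "(e, t0 e) \<notin> bd A"
  shows "(e, t2 e) \<in> bd (A \<union> quad e)"
proof -
  interpret S: edge_switch t1 "tw A" "tw (A \<union> quad e)" \<Psi> e "t2 e" "t0 e" "t2 (t0 e)"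
    by (rule switch[OF assms(1-3)])
  show ?thesis using S.joined_if_separate assms(4) unfolding bd_def .
qed

lemma eg_step_le:
  assumes "edges A" "e \<in> A0" "e \<notin> A"
  shows "eg A \<le> eg (A \<union> quad e)"
  using eg_step[OF assms] joined_if_separate[OF assms] bd_le_cc[OF assms(1)]
  by (auto split: if_splits)

lemma edges_induct [consumes 3, case_names base step]:
  assumes "edges A" "edges B" "A \<subseteq> B"
    and "P A" and "\<And>X e. edges X \<Longrightarrow> A \<subseteq> X \<Longrightarrow> X \<union> quad e \<subseteq> B \<Longrightarrow> e \<in> A0 \<Longrightarrow> e \<notin> X \<Longrightarrow> P X \<Longrightarrow> P (X \<union> quad e)"
  shows "P B"
proof -
  have "P B" if "edges X" "A \<subseteq> X" "X \<subseteq> B" "P X" for X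
    using that
  proof (induction "card (B - X)" arbitrary: X rule: less_induct)
    case less
    show ?case
    proof (cases "X = B")
      case True
      then show ?thesis using less by simp
    next
      case False
      then obtain e where e: "e \<in> B" "e \<notin> X" using less by blast
      have "quad e \<subseteq> B" using e assms(2) by (auto simp: quad_def edges_def)
      have "e \<in> A0" using e assms(2) by (auto simp: edges_def)
      have "card (B - (X \<union> quad e)) < card (B - X)"
        by (rule psubset_card_mono) (use e finite_edges[OF assms(2)] in \<open>auto simp: quad_def\<close>)
      moreover have "P (X \<union> quad e)"
        using assms(5)[of X e] less \<open>quad e \<subseteq> B\<close> \<open>e \<in> A0\<close> e by simp
      ultimately show ?thesis
        using less \<open>quad e \<subseteq> B\<close> edges_quad[OF less(2) \<open>e \<in> A0\<close>] by (intro less(1)) auto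
    qed
  qed
  from this[of A] show ?thesis using assms by simp
qed

lemma four_dvd_card_edges:
  assumes "edges A"
  shows "4 dvd card A"
  using edges_empty assms empty_subsetI
  by (induction rule: edges_induct) (auto simp: card_Un_quad)

lemma eg_mono:
  assumes "edges A" "edges B" "A \<subseteq> B"
  shows "eg A \<le> eg B"
  using assms
proof (induction rule: edges_induct)
  case (step X e)
  then show ?case using eg_step_le[of X e] by linarith
qed simp

lemma bd_empty: "bd {} = conn {t1, t2}"
proof -
  have "tw {} = t2" by (auto simp: twist_def)
  then show ?thesis by (simp add: bd_def)
qed

lemma eg_empty: "eg {} = 0"
proof -
  have "cc {} = bd {}"
  proof
    show "bd {} \<subseteq> cc {}" by (rule bd_le_cc[OF edges_empty])
    show "cc {} \<subseteq> bd {}"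
      unfolding cc_def
      by (rule conn_least[OF equiv_bd[OF edges_empty]]) (auto simp: bd_empty intro: conn_step)
  qed
  then show ?thesis by (simp add: eg_def)
qed

lemma eg_nonneg: "edges A \<Longrightarrow> 0 \<le> eg A"
  using eg_mono[OF edges_empty, of A] eg_empty by simp

text \<open>An orientation of the ribbon graph with edge set \<open>A\<close>.\<close>

definition colouring :: "'x set \<Rightarrow> ('x \<Rightarrow> bool) \<Rightarrow> bool" where
  "colouring A c \<longleftrightarrow> (\<forall>x \<in> \<Psi>. c (t1 x) = (\<not> c x) \<and> c (t2 x) = (\<not> c x)) \<and> (\<forall>x \<in> A. c (t0 x) = (\<not> c x))"

lemma colouring_tw: "colouring A c \<Longrightarrow> x \<in> \<Psi> \<Longrightarrow> c (tw A x) = (\<not> c x)"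
  by (auto simp: colouring_def twist_def)

lemma colouring_t1: "colouring A c \<Longrightarrow> x \<in> \<Psi> \<Longrightarrow> c (t1 x) = (\<not> c x)"
  by (simp add: colouring_def)

lemma colouring_mono: "colouring B c \<Longrightarrow> A \<subseteq> B \<Longrightarrow> colouring A c"
  by (simp add: colouring_def subset_iff)

text \<open>With a colouring, an edge that meets a single boundary component splits it
  (\<open>split_if_coloured\<close>), so each increment is 0 or 2.\<close>

lemma even_eg:
  assumes "edges A" "colouring A c"
  shows "even (eg A)"
  using edges_empty assms(1) empty_subsetI
proof (induction rule: edges_induct)
  case base
  then show ?case by (simp add: eg_empty)
next
  case (step X e)
  interpret S: edge_switch t1 "tw X" "tw (X \<union> quad e)" \<Psi> e "t2 e" "t0 e" "t2 (t0 e)"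
    by (rule switch) (use step in auto)
  have col: "colouring X c" "colouring (X \<union> quad e) c"
    using colouring_mono[OF assms(2)] step(3) by auto
  have "(e, t2 e) \<notin> bd (X \<union> quad e)" if "(e, t0 e) \<in> bd X"
    using S.split_if_coloured[of c, OF colouring_t1[OF assms(2)] colouring_tw[OF col(1)] colouring_tw[OF col(2)]]
      that unfolding bd_def by simp
  then show ?case using eg_step[OF step(1,4,5)] joined_if_separate[OF step(1,4,5)] step.IH
    by (auto split: if_splits)
qed

text \<open>Every increment must be 0. If the ends of a new edge are coloured inconsistently, its
  two sides lie on one boundary component (\<open>joined_if_same_colour\<close>), and increment 0
  then forces it to join two components, one of which can be reoriented.\<close>

lemma colouring_if_eg_0:
  assumes "edges A" "eg A = 0"
  shows "\<exists>c. colouring A c"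
proof -
  \<comment> \<open>As an inequality the hypothesis passes down to smaller edge sets by
    monotonicity.\<close>
  have "eg A \<le> 0 \<longrightarrow> (\<exists>c. colouring A c)"
    using edges_empty assms(1) empty_subsetI
  proof (induction rule: edges_induct)
    case base
    obtain c where "\<And>x. c (t1 x) = (\<not> c x) \<and> c (t2 x) = (\<not> c x)"
      using bipartite_involutions[OF t1 t2] by blast
    then have "colouring {} c" by (simp add: colouring_def)
    then show ?case by blast
  next
    case (step X e)
    show ?case
    proof
      assume le: "eg (X \<union> quad e) \<le> 0"
      with eg_step_le[OF step(1,4,5)] step.IH obtain c where c: "colouring X c" by auto
      have e: "e \<in> \<Psi>" "t0 e \<in> \<Psi>" using step A0 A0_closed by auto
      have extend: "colouring (X \<union> quad e) c" if "colouring X c" "c (t0 e) = (\<not> c e)" for c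
        using that e t0 unfolding colouring_def quad_def by (auto simp: comm)
      show "\<exists>c. colouring (X \<union> quad e) c"
      proof (cases "c (t0 e) = c e")
        case False
        then show ?thesis using extend[OF c] by blast
      next
        case True
        interpret S: edge_switch t1 "tw X" "tw (X \<union> quad e)" \<Psi> e "t2 e" "t0 e" "t2 (t0 e)"
          by (rule switch) (use step in auto)
        have "(e, t2 e) \<in> bd (X \<union> quad e)"
          using S.joined_if_same_colour[of c, OF colouring_t1[OF c] colouring_tw[OF c]] True
          unfolding bd_def by simp
        then have "(e, t0 e) \<notin> cc X"
          using eg_step[OF step(1,4,5)] le eg_nonneg[OF step(1)] by (auto split: if_splits)
        \<comment> \<open>Reverse the orientation of the component of \<open>e\<close>; it does not
          contain \<open>t0 e\<close>, so the new edge becomes consistent.\<close>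
        define c' where "c' x = (if (e, x) \<in> cc X then \<not> c x else c x)" for x
        note E = equiv_UNIV_D[OF equiv_cc[OF step(1)]]
        have inv: "(e, t1 x) \<in> cc X \<longleftrightarrow> (e, x) \<in> cc X" "(e, t2 x) \<in> cc X \<longleftrightarrow> (e, x) \<in> cc X"
          "x \<in> X \<Longrightarrow> (e, t0 x) \<in> cc X \<longleftrightarrow> (e, x) \<in> cc X" for x
        proof -
          have s: "(x, t1 x) \<in> cc X" "(x, t2 x) \<in> cc X" "x \<in> X \<Longrightarrow> (x, t0 x) \<in> cc X"
            using cc_step[of x X] by auto
          show "(e, t1 x) \<in> cc X \<longleftrightarrow> (e, x) \<in> cc X" using E(2,3) s(1) by blast
          show "(e, t2 x) \<in> cc X \<longleftrightarrow> (e, x) \<in> cc X" using E(2,3) s(2) by blast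
          show "(e, t0 x) \<in> cc X \<longleftrightarrow> (e, x) \<in> cc X" if "x \<in> X" using E(2,3) s(3)[OF that] by blast
        qed
        have "colouring X c'" using c inv by (auto simp: colouring_def c'_def)
        moreover have "c' (t0 e) = (\<not> c' e)"
          using True \<open>(e, t0 e) \<notin> cc X\<close> E(1)[of e] by (simp add: c'_def)
        ultimately show ?thesis using extend by blast
      qed
    qed
  qed
  with assms(2) show ?thesis by simp
qed

text \<open>A thickened path is a disc, and its boundary circle serves as the vertex to which the
  path is contracted. Each chosen edge leads to a vertex not met before, so it fuses two boundary
  components and lowers their number by exactly one.\<close>

lemma contract_path:
  assumes vl: "\<And>x y. x \<in> \<Psi> \<Longrightarrow> y \<in> \<Psi> \<Longrightarrow> (x, y) \<in> bd {} \<longleftrightarrow> vl x = vl y"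
    and "ws \<noteq> []" "distinct ws"
    and "\<And>i. Suc i < length ws \<Longrightarrow> \<exists>e \<in> A0. vl e = ws ! i \<and> vl (t0 e) = ws ! Suc i"
  obtains C where "edges C" "vl ` C \<subseteq> set ws"
    "card (\<Psi> // bd C) + card C div 4 = card (\<Psi> // bd {})"
    "\<And>x y. x \<in> \<Psi> \<Longrightarrow> y \<in> \<Psi> \<Longrightarrow> (x, y) \<in> bd C \<longleftrightarrow> vl x = vl y \<or> vl x \<in> set ws \<and> vl y \<in> set ws"
proof -
  have "\<exists>C. edges C \<and> vl ` C \<subseteq> set ws \<and> card (\<Psi> // bd C) + card C div 4 = card (\<Psi> // bd {}) \<and>
    (\<forall>x \<in> \<Psi>. \<forall>y \<in> \<Psi>. (x, y) \<in> bd C \<longleftrightarrow> vl x = vl y \<or> vl x \<in> set ws \<and> vl y \<in> set ws)"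
    using assms(2-4)
  proof (induction ws rule: rev_nonempty_induct)
    case (single w)
    show ?case by (rule exI[of _ "{}"]) (use vl edges_empty in auto)
  next
    case (snoc w ws)
    have "\<exists>e \<in> A0. vl e = ws ! i \<and> vl (t0 e) = ws ! Suc i" if "Suc i < length ws" for i
      using snoc.prems(2)[of i] that by (simp add: nth_append)
    with snoc obtain C where C: "edges C" "vl ` C \<subseteq> set ws"
      "card (\<Psi> // bd C) + card C div 4 = card (\<Psi> // bd {})"
      "\<And>x y. x \<in> \<Psi> \<Longrightarrow> y \<in> \<Psi> \<Longrightarrow> (x, y) \<in> bd C \<longleftrightarrow> vl x = vl y \<or> vl x \<in> set ws \<and> vl y \<in> set ws"
      by auto
    obtain k where k: "length ws = Suc k" using snoc.hyps by (cases ws) auto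
    obtain e where e: "e \<in> A0" "vl e = ws ! k" "vl (t0 e) = w"
      using snoc.prems(2)[of k] k by (auto simp: nth_append)
    have ek: "vl e \<in> set ws" using e k by simp
    have w: "w \<notin> set ws" using snoc.prems by simp
    have in\<Psi>: "e \<in> \<Psi>" "t0 e \<in> \<Psi>" "t2 e \<in> \<Psi>" "t2 (t0 e) \<in> \<Psi>" using e(1) A0 A0_closed \<Psi> by auto
    have "t0 e \<notin> C" using C(2) e(3) w by auto
    then have "e \<notin> C" using C(1) by (auto simp: edges_def)
    have sep: "(e, t0 e) \<notin> bd C" using C(4)[of e "t0 e"] in\<Psi> e w ek by auto
    interpret S: edge_switch t1 "tw C" "tw (C \<union> quad e)" \<Psi> e "t2 e" "t0 e" "t2 (t0 e)"
      by (rule switch[OF C(1) e(1) \<open>e \<notin> C\<close>])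
    have bd': "bd (C \<union> quad e) = merge (bd C) e (t0 e)"
      using S.conn_switch S.joined_if_separate sep unfolding bd_def by blast
    have "card (\<Psi> // bd C) = card (\<Psi> // bd (C \<union> quad e)) + 1"
      unfolding bd' using card_quotient_merge[OF equiv_bd[OF C(1)] fin in\<Psi>(1,2)] sep by simp
    moreover have "card (C \<union> quad e) div 4 = card C div 4 + 1"
      using card_Un_quad[OF C(1) e(1) \<open>e \<notin> C\<close>] by simp
    moreover have "vl (t2 x) = vl x" if "x \<in> \<Psi>" for x
    proof -
      have "(x, t2 x) \<in> bd {}" by (auto simp: bd_empty intro: conn_step)
      then show ?thesis using vl[OF that \<Psi>(2)[OF that]] by simp
    qed
    then have "vl ` (C \<union> quad e) \<subseteq> set (ws @ [w])"
      using C(2) e ek in\<Psi> by (auto simp: quad_def comm)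
    moreover have "(x, y) \<in> bd (C \<union> quad e) \<longleftrightarrow> vl x = vl y \<or> vl x \<in> set (ws @ [w]) \<and> vl y \<in> set (ws @ [w])"
      if "x \<in> \<Psi>" "y \<in> \<Psi>" for x y
      unfolding bd' merge_def using that in\<Psi> C(4) e ek by (auto; metis)
    ultimately show ?case using C(3) edges_quad[OF C(1) e(1)]
      by (intro exI[of _ "C \<union> quad e"]) auto
  qed
  then show thesis using that by blast
qed

end

section \<open>The surface of a contracted ribbon graph\<close>

lemma card_image_eq_fibres:
  assumes "\<And>x y. x \<in> X \<Longrightarrow> y \<in> X \<Longrightarrow> f x = f y \<longleftrightarrow> g x = g y"
  shows "card (f ` X) = card (g ` X)"
proof -
  have "bij_betw (\<lambda>u. g (inv_into X f u)) (f ` X) (g ` X)"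
  proof (rule bij_betwI')
    fix u v assume "u \<in> f ` X" "v \<in> f ` X"
    then show "g (inv_into X f u) = g (inv_into X f v) \<longleftrightarrow> u = v"
      using assms by (metis inv_into_into f_inv_into_f)
  next
    fix u assume "u \<in> f ` X"
    then show "g (inv_into X f u) \<in> g ` X" by (simp add: inv_into_into)
  next
    fix v assume "v \<in> g ` X"
    then obtain x where x: "x \<in> X" "v = g x" by blast
    then have "g (inv_into X f (f x)) = g x" using assms by (metis inv_into_into f_inv_into_f imageI)
    then have "v = g (inv_into X f (f x))" using x by simp
    then show "\<exists>u \<in> f ` X. v = g (inv_into X f u)" using x(1) by blast
  qed
  then show ?thesis by (rule bij_betw_same_card)
qed

lemma orbit_imp_rtrancl:
  assumes "f permutes S" "x \<in> S" "y \<in> orbit f x"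
  shows "(x, y) \<in> {(a, f a) | a. a \<in> S}\<^sup>*"
  using assms(3)
proof (induction rule: orbit.induct)
  case base
  show ?case using assms(2) by blast
next
  case (step y)
  have "y \<in> S" using permutes_orbit_subset[OF assms(1,2)] step.hyps by blast
  then have "(y, f y) \<in> {(a, f a) | a. a \<in> S}" by blast
  with step.IH show ?case by (rule rtrancl_into_rtrancl)
qed

lemma equiv_symcl_rtrancl: "equiv UNIV ((symcl R)\<^sup>*)"
proof (rule equivI)
  have "sym (symcl R)" by (auto simp: symcl_def sym_def)
  then show "sym ((symcl R)\<^sup>*)" by (rule sym_rtrancl)
qed (auto intro: refl_rtrancl trans_rtrancl)

lemma vertex_at_eq_iff: "vertex_at S d = vertex_at S e \<longleftrightarrow> (d, e) \<in> (symcl (corner_rel S))\<^sup>*"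
  unfolding vertex_at_def using eq_equiv_class_iff[OF equiv_symcl_rtrancl, of d e "corner_rel S"] by simp

text \<open>The edges of \<open>C\<close> are contracted: the vertices of the new surface are the classes of \<open>bd C\<close>, its
  faces those of \<open>bd A\<close>.\<close>

locale contracted_ribbon = ribbon t0 t1 t2 \<Psi> A0
  for t0 t1 t2 :: "'x \<Rightarrow> 'x" and \<Psi> A0 +
  fixes A C :: "'x set" and c :: "'x \<Rightarrow> bool" and enc :: "'x \<times> bool \<Rightarrow> 'd"
  assumes A: "edges A" and C: "edges C" and CA: "C \<subseteq> A"
    and c: "colouring A c" and enc: "inj enc" and nonempty: "\<Psi> \<noteq> {}"
    and connected: "\<And>x y. x \<in> \<Psi> \<Longrightarrow> y \<in> \<Psi> \<Longrightarrow> (x, y) \<in> cc A"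
    and C_class: "\<And>x. x \<in> C \<Longrightarrow> (x, t2 x) \<in> bd C"
begin

definition "D = {p \<in> \<Psi>. c p}"

text \<open>A dart \<open>p\<close> outside \<open>A - C\<close> is kept as a spike, made of the two sides \<open>(p, False)\<close>
  and \<open>(p, True)\<close> glued to each other; this spares restricting the permutations to \<open>A - C\<close>.\<close>

definition "X = {(p, b). p \<in> D \<and> (b \<longrightarrow> p \<notin> A - C)}"

text \<open>The walk around a face. On flags of one colour the two matchings \<open>t1\<close> and
  \<open>tw A\<close> compose to a permutation, which traverses each boundary component in one
  direction; at a spike both of its sides are inserted.\<close>

definition sc :: "'x \<times> bool \<Rightarrow> 'x \<times> bool" where
  "sc = (\<lambda>(p, b). if b \<or> p \<in> A - C then (t1 (tw A p), False) else (p, True))"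

text \<open>\<open>t2 (t0 p)\<close> is the other flag of the same colour on the edge of
  \<open>p\<close>, at the opposite end and on the opposite side. Glued sides thus run in opposite
  directions, as \<open>parallel\<close> being false demands.\<close>

definition gl :: "'x \<times> bool \<Rightarrow> 'x \<times> bool" where
  "gl = (\<lambda>(p, b). if p \<in> A - C then (t2 (t0 p), b) else (p, \<not> b))"

definition surf :: "'d gluing" where
  "surf = \<lparr>sides = enc ` X,
     succ_side = (\<lambda>n. if n \<in> enc ` X then enc (sc (inv enc n)) else n),
     glue = (\<lambda>n. enc (gl (inv enc n))),
     parallel = (\<lambda>_. False)\<rparr>"

text \<open>Among the flags \<open>x\<close> and \<open>t1 x\<close>, which share a corner, this is
  the coloured one.\<close>

definition "rep x = (if c x then x else t1 x)"

lemma surf_simps [simp]: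
  "sides surf = enc ` X" "x \<in> X \<Longrightarrow> succ_side surf (enc x) = enc (sc x)"
  "glue surf (enc x) = enc (gl x)" "parallel surf n = False"
  using enc by (auto simp: surf_def)

lemma enc_eq [simp]: "enc x = enc y \<longleftrightarrow> x = y"
  using enc by (auto dest: injD)

lemma AC: "edges (A - C)"
  using A C t0 t2 unfolding edges_def by (metis DiffD1 DiffD2 DiffI subset_iff)

lemma AC_closed: "p \<in> A - C \<Longrightarrow> t0 p \<in> A - C" "p \<in> A - C \<Longrightarrow> t2 p \<in> A - C"
  using AC by (auto simp: edges_def)

lemma A_in: "p \<in> A \<Longrightarrow> p \<in> \<Psi>" "p \<in> A \<Longrightarrow> p \<in> A0"
  using A A0 by (auto simp: edges_def)

lemma c_flip: "x \<in> \<Psi> \<Longrightarrow> c (t1 x) = (\<not> c x)" "x \<in> \<Psi> \<Longrightarrow> c (t2 x) = (\<not> c x)" "x \<in> A \<Longrightarrow> c (t0 x) = (\<not> c x)"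
  using c by (auto simp: colouring_def)

lemma colouring_C: "colouring C c"
  using c CA by (auto simp: colouring_def)

lemma next_in_D: "p \<in> D \<Longrightarrow> t1 (tw A p) \<in> D" "p \<in> D \<Longrightarrow> t1 (tw C p) \<in> D"
  using colouring_tw[OF c] colouring_tw[OF colouring_C] tw_in[OF A] tw_in[OF C] c_flip \<Psi>
  by (auto simp: D_def)

lemma glued_in_D: "p \<in> D \<Longrightarrow> p \<in> A - C \<Longrightarrow> t2 (t0 p) \<in> D"
  using c_flip AC_closed A_in by (auto simp: D_def)

lemma sc_in: "x \<in> X \<Longrightarrow> sc x \<in> X"
  using next_in_D by (cases x) (auto simp: X_def sc_def)

lemma gl_in: "x \<in> X \<Longrightarrow> gl x \<in> X"
  using glued_in_D AC_closed by (auto simp: X_def gl_def split: if_splits)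

lemma gl_gl: "gl (gl x) = x" and gl_neq: "gl x \<noteq> x"
proof -
  obtain p b where x: "x = (p, b)" by (cases x)
  have "t2 (t0 (t2 (t0 p))) = p" using t0 t2 by (simp add: comm)
  moreover have "t2 (t0 p) \<noteq> p" if "p \<in> A - C"
    using t02[OF A_in(2)] that t2 by (metis DiffD1)
  ultimately show "gl (gl x) = x" "gl x \<noteq> x"
    using AC_closed[of p] AC_closed(2)[of "t0 p"] x by (auto simp: gl_def)
qed

lemma finite_D: "finite D" using fin by (simp add: D_def)

lemma finite_X: "finite X"
  by (rule finite_subset[of _ "D \<times> UNIV"]) (use finite_D in \<open>auto simp: X_def\<close>)

lemma inj_sc: "inj_on sc X"
proof (rule inj_onI)
  have inj: "p = q" if "t1 (tw A p) = t1 (tw A q)" for p q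
    using that t1 tw_invol[OF A] by metis
  fix x y assume "x \<in> X" "y \<in> X" "sc x = sc y"
  then show "x = y"
    by (cases x; cases y) (auto simp: sc_def X_def split: if_splits dest: inj)
qed

lemma succ_permutes: "succ_side surf permutes sides surf"
proof (rule bij_imp_permutes)
  have "sc ` X = X"
    using sc_in finite_X inj_sc by (metis endo_inj_surj image_subsetI)
  then have "bij_betw sc X X" using inj_sc by (simp add: bij_betw_def)
  moreover have "bij_betw enc X (enc ` X)" "bij_betw (inv enc) (enc ` X) X"
    using enc by (auto simp: bij_betw_def inj_on_def image_image)
  ultimately have "bij_betw (enc \<circ> sc \<circ> inv enc) (enc ` X) (enc ` X)"
    by (metis bij_betw_trans comp_assoc)
  then show "bij_betw (succ_side surf) (sides surf) (sides surf)"
    unfolding surf_def by (simp add: bij_betw_cong[of "enc ` X" "\<lambda>n. if n \<in> enc ` X then enc (sc (inv enc n)) else n" "enc \<circ> sc \<circ> inv enc"])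
qed (simp add: surf_def)

lemma permutation_succ: "permutation (succ_side surf)"
  using succ_permutes finite_X by (auto simp: permutation_permutes)

lemma rep_in: "x \<in> \<Psi> \<Longrightarrow> rep x \<in> D" "x \<in> \<Psi> \<Longrightarrow> (rep x, False) \<in> X"
  using c_flip \<Psi> by (auto simp: rep_def D_def X_def)

lemma rep_D: "p \<in> D \<Longrightarrow> rep p = p" by (simp add: rep_def D_def)

lemma rep_t1: "x \<in> \<Psi> \<Longrightarrow> rep (t1 x) = rep x"
  using c_flip t1 by (auto simp: rep_def)

lemma rep_bd: "(rep x, x) \<in> bd B" "(x, rep x) \<in> bd B"
  using bd_step(1)[of x B] bd_step(1)[of "t1 x" B] t1 by (auto simp: rep_def bd_def)

lemma bd_next: "(p, t1 (tw B p)) \<in> bd B"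
  using bd_step(1)[of "tw B p" B] bd_step(2)[of p B] conn_trans unfolding bd_def by metis

text \<open>Passes from the matchings on all flags to the permutation on \<open>D\<close>: a step of
  \<open>bd B\<close> is read forwards from a coloured flag and backwards from an uncoloured one. It
  serves for the faces with \<open>B = A\<close> and for the vertices with
  \<open>B = C\<close>.\<close>

lemma dart_invariant:
  assumes E: "equiv UNIV E" and B: "edges B" "colouring B c"
    and step: "\<And>p. p \<in> D \<Longrightarrow> (enc (p, False), enc (t1 (tw B p), False)) \<in> E"
    and "(x, y) \<in> bd B" "x \<in> \<Psi>"
  shows "(enc (rep x, False), enc (rep y, False)) \<in> E"
proof -
  note Ed = equiv_UNIV_D[OF E]
  have "y \<in> \<Psi> \<and> (enc (rep x, False), enc (rep y, False)) \<in> E"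
    using assms(5) unfolding bd_def
  proof (induction rule: conn_induct)
    case base
    show ?case using Ed(1) \<open>x \<in> \<Psi>\<close> by simp
  next
    case (step f y)
    then consider "f = t1" | "f = tw B" by auto
    then show ?case
    proof cases
      case 1
      then show ?thesis using step.IH rep_t1 \<Psi> by simp
    next
      case 2
      have w: "tw B y \<in> \<Psi>" "c (tw B y) = (\<not> c y)" using step.IH tw_in[OF B(1)] colouring_tw[OF B(2)] by auto
      have "(enc (rep y, False), enc (rep (tw B y), False)) \<in> E"
      proof (cases "c y")
        case True
        then show ?thesis using assms(4)[of y] step.IH w by (simp add: rep_def D_def)
      next
        case False
        then have "(enc (tw B y, False), enc (t1 y, False)) \<in> E"
          using assms(4)[of "tw B y"] w tw_invol[OF B(1)] by (simp add: D_def)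
        then show ?thesis using Ed(2) False w by (simp add: rep_def)
      qed
      then show ?thesis using 2 w step.IH Ed(3) by blast
    qed
  qed
  then show ?thesis by blast
qed

lemma dart_step:
  assumes "p \<in> D" and E: "equiv UNIV E"
    and "\<And>d. d \<in> sides surf \<Longrightarrow> (d, succ_side surf d) \<in> E"
  shows "(enc (p, False), enc (t1 (tw A p), False)) \<in> E"
proof -
  have X: "(p, False) \<in> X" using assms(1) by (simp add: X_def)
  show ?thesis
  proof (cases "p \<in> A - C")
    case True
    then show ?thesis using assms(3)[of "enc (p, False)"] X by (auto simp: sc_def)
  next
    case False
    then have "(p, True) \<in> X" using assms(1) by (simp add: X_def)
    then have "(enc (p, False), enc (p, True)) \<in> E" "(enc (p, True), enc (t1 (tw A p), False)) \<in> E"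
      using False X assms(3)[of "enc (p, False)"] assms(3)[of "enc (p, True)"] by (auto simp: sc_def)
    then show ?thesis using equiv_UNIV_D(3)[OF E] by blast
  qed
qed

text \<open>Gluing and then taking the next side turns around a point of the surface. On
  \<open>A - C\<close> the \<open>t0\<close> of the gluing cancels that of the face walk and leaves
  \<open>t2\<close>, so the turn is a boundary walk of \<open>C\<close>. This is why the points are
  the classes of \<open>bd C\<close>.\<close>

lemma succ_glue: "p \<in> D \<Longrightarrow> sc (gl (p, False)) = (t1 (tw C p), False)"
proof (cases "p \<in> A - C")
  case True
  then have "t2 (t0 p) \<in> A - C" "tw A (t2 (t0 p)) = t2 p" "tw C p = t2 p"
    using AC_closed[of p] AC_closed(2)[of "t0 p"] t0 by (auto simp: twist_def comm)
  then show ?thesis using True by (auto simp: sc_def gl_def)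
next
  case False
  then have "tw A p = tw C p" using CA by (auto simp: twist_def)
  then show ?thesis using False by (auto simp: sc_def gl_def)
qed

lemma corner_rel_surf: "corner_rel surf = (\<lambda>x. (enc x, enc (sc (gl x)))) ` X"
  using gl_in by (auto simp: corner_rel_def image_iff)

lemma surf_closed: "closed_surface surf"
  unfolding closed_surface_def
proof (intro conjI ballI)
  obtain x where "x \<in> \<Psi>" using nonempty by blast
  then show "sides surf \<noteq> {}" using rep_in(2) by auto
  show "finite (sides surf)" using finite_X by simp
  show "succ_side surf permutes sides surf" by (rule succ_permutes)
next
  fix d assume "d \<in> sides surf"
  then show "glue surf d \<in> sides surf" "glue surf d \<noteq> d" "glue surf (glue surf d) = d"
    "parallel surf (glue surf d) = parallel surf d"
    using gl_in gl_gl gl_neq by auto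
next
  define R where "R = {(a, succ_side surf a) | a. a \<in> sides surf} \<union> {(a, glue surf a) | a. a \<in> sides surf}"
  \<comment> \<open>Reachability by directed steps is made symmetric; the relation loses nothing,
    because the permutation has finite cycles and the gluing is an involution.\<close>
  define E where "E = {(d, e). (d, e) \<in> R\<^sup>* \<and> (e, d) \<in> R\<^sup>*}"
  have E: "equiv UNIV E"
    by (rule equivI) (auto simp: E_def refl_on_def sym_def trans_def)
  note Ed = equiv_UNIV_D[OF E]
  have E_succ: "(d, succ_side surf d) \<in> E" if "d \<in> sides surf" for d
  proof -
    have "(d, succ_side surf d) \<in> R" using that by (auto simp: R_def)
    moreover have "succ_side surf d \<in> sides surf" using succ_permutes that by (simp only: permutes_in_image)
    moreover have "d \<in> orbit (succ_side surf) (succ_side surf d)"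
      using permutation_self_in_orbit[OF permutation_succ] permutation_orbit_step[OF permutation_succ] by blast
    ultimately have "(succ_side surf d, d) \<in> {(a, succ_side surf a) | a. a \<in> sides surf}\<^sup>*"
      using orbit_imp_rtrancl[OF succ_permutes] by blast
    moreover have "{(a, succ_side surf a) | a. a \<in> sides surf}\<^sup>* \<subseteq> R\<^sup>*"
      by (rule rtrancl_mono) (auto simp: R_def)
    ultimately show ?thesis using \<open>(d, succ_side surf d) \<in> R\<close> by (auto simp: E_def)
  qed
  have E_glue: "(d, glue surf d) \<in> E" if d: "d \<in> sides surf" for d
  proof -
    have "(d, glue surf d) \<in> R" using d by (auto simp: R_def)
    moreover obtain x where x: "x \<in> X" "d = enc x" using d by auto
    then have "(enc (gl x), glue surf (enc (gl x))) \<in> R" unfolding R_def using gl_in by auto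
    ultimately show ?thesis using x gl_gl unfolding E_def by auto
  qed
  have E_A: "(enc (rep x, False), enc (rep y, False)) \<in> E" if "(x, y) \<in> bd A" "x \<in> \<Psi>" for x y
    by (rule dart_invariant[OF E A c dart_step[OF _ E E_succ] that])
  have E_C: "(enc (rep x, False), enc (rep y, False)) \<in> E" if "(x, y) \<in> bd C" "x \<in> \<Psi>" for x y
  proof (rule dart_invariant[OF E C colouring_C _ that])
    fix p assume p: "p \<in> D"
    then have X: "(p, False) \<in> X" by (simp add: X_def)
    have "(enc (p, False), enc (gl (p, False))) \<in> E" using E_glue[of "enc (p, False)"] X by simp
    moreover have "(enc (gl (p, False)), enc (sc (gl (p, False)))) \<in> E"
      using E_succ[of "enc (gl (p, False))"] gl_in[OF X] by simp
    ultimately show "(enc (p, False), enc (t1 (tw C p), False)) \<in> E"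
      using Ed(3) succ_glue[OF p] by auto
  qed
  have E_cc: "(enc (rep x, False), enc (rep y, False)) \<in> E" if "(x, y) \<in> cc A" "x \<in> \<Psi>" for x y
  proof -
    have "y \<in> \<Psi> \<and> (enc (rep x, False), enc (rep y, False)) \<in> E"
      using that(1) unfolding cc_def
    proof (induction rule: conn_induct)
      case base
      show ?case using Ed(1) \<open>x \<in> \<Psi>\<close> by simp
    next
      case (step f y)
      have bdA: "(y, tw A y) \<in> bd A" "(y, tw C y) \<in> bd C" by (rule bd_step)+
      from step.hyps consider "f = t1" | "f = t2" | "f y = y" | "f y = t0 y" "y \<in> A" by (cases "y \<in> A") auto
      then show ?case
      proof cases
        case 1
        then show ?thesis using step.IH rep_t1 \<Psi> by simp
      next
        case 2
        \<comment> \<open>Off \<open>A\<close> this crossing is a step along a face and on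
          \<open>A - C\<close> a step around a vertex. For a contracted edge, both sides lie at the
          same new vertex by \<open>C_class\<close>.\<close>
        have "(y, t2 y) \<in> bd A \<or> (y, t2 y) \<in> bd C"
          using bdA C_class by (cases "y \<in> C"; cases "y \<in> A") (auto simp: twist_def)
        then show ?thesis using 2 step.IH E_A E_C \<Psi> Ed(3) by blast
      next
        case 3
        then show ?thesis using step.IH by simp
      next
        case 4
        then have "(y, t0 y) \<in> bd A" "t0 y \<in> \<Psi>" using bdA A A_in by (auto simp: twist_def edges_def)
        then show ?thesis using 4 step.IH E_A Ed(3) by auto
      qed
    qed
    then show ?thesis by blast
  qed
  have to_base: "(enc (p, False), enc (p, b)) \<in> E" if "(p, b) \<in> X" for p b
  proof (cases b)
    case True
    then have "(p, False) \<in> X" "p \<notin> A - C" using that by (auto simp: X_def)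
    then show ?thesis using E_succ[of "enc (p, False)"] True by (auto simp: sc_def)
  next
    case False
    then show ?thesis using Ed(1) by simp
  qed
  fix d e assume "d \<in> sides surf" "e \<in> sides surf"
  then obtain p b q b' where pq: "d = enc (p, b)" "(p, b) \<in> X" "e = enc (q, b')" "(q, b') \<in> X" by auto
  then have "p \<in> D" "q \<in> D" by (auto simp: X_def)
  then have "(enc (p, False), enc (q, False)) \<in> E"
    using E_cc[of p q] connected[of p q] rep_D by (auto simp: D_def)
  then have "(d, e) \<in> E" using to_base[OF pq(2)] to_base[OF pq(4)] Ed(2,3) unfolding pq(1,3) by blast
  then show "(d, e) \<in> ({(a, succ_side surf a) | a. a \<in> sides surf} \<union> {(a, glue surf a) | a. a \<in> sides surf})\<^sup>*"
    by (simp add: E_def R_def)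
qed

lemma surf_orientable: "orientable surf"
  unfolding orientable_def by (rule exI[of _ "\<lambda>_. True"]) simp

text \<open>Names for the points of the surface. The side \<open>(p, True)\<close> of a spike starts
  at its tip, which is a point of its own.\<close>

definition vtx :: "'x \<times> bool \<Rightarrow> 'x set + 'x" where
  "vtx = (\<lambda>(p, b). if b then Inr p else Inl (bd C `` {p}))"

lemma vertex_at_surf:
  assumes "x \<in> X" "y \<in> X"
  shows "vertex_at surf (enc x) = vertex_at surf (enc y) \<longleftrightarrow> vtx x = vtx y"
proof -
  let ?E = "(symcl (corner_rel surf))\<^sup>*"
  note Eq = equiv_symcl_rtrancl[of "corner_rel surf"]
  have inv: "vtx (sc (gl x)) = vtx x" if "x \<in> X" for x
  proof -
    obtain p b where x: "x = (p, b)" by (cases x)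
    have p: "p \<in> D" using x that by (simp add: X_def)
    show ?thesis
    proof (cases b)
      case True
      then show ?thesis using x that by (auto simp: X_def gl_def sc_def)
    next
      case False
      have "(p, t1 (tw C p)) \<in> bd C" by (rule bd_next)
      then show ?thesis
        using x False succ_glue[OF p] eq_equiv_class_iff[OF equiv_bd[OF C]] equiv_UNIV_D(2)[OF equiv_bd[OF C]]
        by (auto simp: vtx_def)
    qed
  qed
  have "vtx x = vtx (inv enc d)" if "(enc x, d) \<in> ?E" for d
    using that
  proof (induction rule: rtrancl_induct)
    case base
    show ?case using enc by simp
  next
    case (step d e)
    from step.hyps(2) obtain y where "y \<in> X" "(d, e) = (enc y, enc (sc (gl y))) \<or> (e, d) = (enc y, enc (sc (gl y)))"
      unfolding corner_rel_surf symcl_def by auto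
    then show ?case using step.IH inv[of y] enc by auto
  qed
  from this[of "enc y"] have "vtx x = vtx y" if "(enc x, enc y) \<in> ?E"
    using that enc by simp
  moreover have "(enc x, enc y) \<in> ?E" if v: "vtx x = vtx y"
  proof -
    obtain p b q b' where xy: "x = (p, b)" "y = (q, b')" by (cases x; cases y)
    show ?thesis
    proof (cases b)
      case True
      then have "x = y" using v xy by (auto simp: vtx_def split: if_splits)
      then show ?thesis by simp
    next
      case False
      have pq: "p \<in> D" "q \<in> D" "p \<in> \<Psi>" using assms xy by (auto simp: X_def D_def)
      from v xy False have b: "\<not> b'" and "bd C `` {p} = bd C `` {q}" by (auto simp: vtx_def split: if_splits)
      then have "(p, q) \<in> bd C" using eq_equiv_class_iff[OF equiv_bd[OF C]] by simp
      have "(enc (rep p, False), enc (rep q, False)) \<in> ?E"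
      proof (rule dart_invariant[OF Eq C colouring_C _ \<open>(p, q) \<in> bd C\<close> pq(3)])
        fix p assume p: "p \<in> D"
        then have "(p, False) \<in> X" by (simp add: X_def)
        then have "(enc (p, False), enc (t1 (tw C p), False)) \<in> corner_rel surf"
          unfolding corner_rel_surf
          by (intro image_eqI[where x = "(p, False)"]) (simp_all add: succ_glue[OF p])
        then show "(enc (p, False), enc (t1 (tw C p), False)) \<in> ?E"
          by (auto simp: symcl_def)
      qed
      then show ?thesis using pq rep_D xy False b by simp
    qed
  qed
  ultimately show ?thesis unfolding vertex_at_eq_iff by blast
qed

lemma orbit_surf:
  assumes "x \<in> X" "y \<in> X"
  shows "orbit (succ_side surf) (enc x) = orbit (succ_side surf) (enc y) \<longleftrightarrow> bd A `` {fst x} = bd A `` {fst y}"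
proof -
  let ?o = "orbit (succ_side surf)"
  define E where "E = {(d, e). ?o d = ?o e}"
  have E: "equiv UNIV E" by (rule equivI) (auto simp: E_def refl_on_def sym_def trans_def)
  note Ed = equiv_UNIV_D[OF E]
  have E_succ: "(d, succ_side surf d) \<in> E" for d
    using permutation_orbit_step[OF permutation_succ] by (simp add: E_def)
  have "\<exists>w \<in> X. d = enc w \<and> bd A `` {fst x} = bd A `` {fst w}" if "d \<in> ?o (enc x)" for d
    using that
  proof (induction rule: orbit.induct)
    have inv: "bd A `` {fst (sc w)} = bd A `` {fst w}" for w
    proof -
      have "(fst w, t1 (tw A (fst w))) \<in> bd A" by (rule bd_next)
      then show ?thesis using eq_equiv_class_iff[OF equiv_bd[OF A]] equiv_UNIV_D(2)[OF equiv_bd[OF A]] by (cases w) (auto simp: sc_def)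
    qed
    case base
    show ?case using assms sc_in inv by (intro bexI[of _ "sc x"]) auto
    case (step d)
    then obtain w where "w \<in> X" "d = enc w" "bd A `` {fst x} = bd A `` {fst w}" by blast
    then show ?case using sc_in inv by (intro bexI[of _ "sc w"]) auto
  qed
  from this[of "enc y"] have "bd A `` {fst x} = bd A `` {fst y}" if "?o (enc x) = ?o (enc y)"
    using that permutation_self_in_orbit[OF permutation_succ] by auto
  moreover have "?o (enc x) = ?o (enc y)" if "bd A `` {fst x} = bd A `` {fst y}"
  proof -
    have to_base: "(enc (p, False), enc (p, b)) \<in> E" if "(p, b) \<in> X" for p b
    proof (cases b)
      case True
      then have "(p, False) \<in> X" "p \<notin> A - C" using that by (auto simp: X_def)
      then show ?thesis using E_succ[of "enc (p, False)"] True by (auto simp: sc_def)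
    next
      case False
      then show ?thesis using Ed(1) by simp
    qed
    obtain p b q b' where xy: "x = (p, b)" "y = (q, b')" by (cases x; cases y)
    have pq: "p \<in> D" "q \<in> D" "p \<in> \<Psi>" using assms xy by (auto simp: X_def D_def)
    have "(p, q) \<in> bd A" using that xy eq_equiv_class_iff[OF equiv_bd[OF A]] by simp
    from dart_invariant[OF E A c dart_step[OF _ E E_succ] this pq(3)]
    have "(enc (p, False), enc (q, False)) \<in> E" using pq rep_D by simp
    then have "(enc x, enc y) \<in> E" using to_base assms xy Ed(2,3) by blast
    then show ?thesis by (simp add: E_def)
  qed
  ultimately show ?thesis by blast
qed

text \<open>The second summand counts the tips of the spikes.\<close>

lemma card_vertices: "card (surf_vertices surf) = card (\<Psi> // bd C) + card (D - (A - C))"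
proof -
  have "card (surf_vertices surf) = card ((\<lambda>x. vertex_at surf (enc x)) ` X)"
    by (simp add: surf_vertices_def image_image)
  also have "\<dots> = card (vtx ` X)" by (rule card_image_eq_fibres) (rule vertex_at_surf)
  also have "vtx ` X = Inl ` (\<Psi> // bd C) \<union> Inr ` (D - (A - C))"
  proof (intro equalityI subsetI)
    fix v assume "v \<in> vtx ` X"
    then show "v \<in> Inl ` (\<Psi> // bd C) \<union> Inr ` (D - (A - C))"
      by (auto simp: vtx_def X_def D_def quotient_def split: if_splits)
  next
    fix v assume "v \<in> Inl ` (\<Psi> // bd C) \<union> Inr ` (D - (A - C))"
    then consider x where "x \<in> \<Psi>" "v = Inl (bd C `` {x})" | p where "p \<in> D - (A - C)" "v = Inr p"
      by (auto elim!: quotientE)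
    then show "v \<in> vtx ` X"
    proof cases
      case 1
      then have "v = vtx (rep x, False)"
        using rep_bd(2)[of x C] eq_equiv_class_iff[OF equiv_bd[OF C]] by (simp add: vtx_def)
      then show ?thesis using rep_in 1 by blast
    next
      case 2
      then have "v = vtx (p, True)" "(p, True) \<in> X" by (auto simp: vtx_def X_def)
      then show ?thesis by blast
    qed
  qed
  also have "card \<dots> = card (Inl ` (\<Psi> // bd C) :: ('x set + 'x) set) + card (Inr ` (D - (A - C)) :: ('x set + 'x) set)"
    using fin finite_D by (intro card_Un_disjoint) (auto simp: quotient_def)
  finally show ?thesis by (simp add: card_image)
qed

lemma card_faces: "card (surf_faces surf) = card (\<Psi> // bd A)"
proof -
  have "card (surf_faces surf) = card ((\<lambda>x. orbit (succ_side surf) (enc x)) ` X)"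
    by (simp add: surf_faces_def image_image)
  also have "\<dots> = card ((\<lambda>x. bd A `` {fst x}) ` X)" by (rule card_image_eq_fibres) (rule orbit_surf)
  also have "(\<lambda>x. bd A `` {fst x}) ` X = \<Psi> // bd A"
  proof (intro equalityI subsetI)
    fix v assume "v \<in> \<Psi> // bd A"
    then obtain x where x: "x \<in> \<Psi>" "v = bd A `` {x}" by (auto elim: quotientE)
    then have "v = bd A `` {fst (rep x, False)}"
      using rep_bd(2)[of x A] eq_equiv_class_iff[OF equiv_bd[OF A]] by simp
    then show "v \<in> (\<lambda>x. bd A `` {fst x}) ` X" using rep_in x by blast
  qed (auto simp: X_def D_def quotient_def)
  finally show ?thesis .
qed

lemma card_AC: "card (A - C) = 2 * card (D \<inter> (A - C))"
proof -
  have fAC: "finite (A - C)" by (rule finite_edges[OF AC])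
  have "card {x \<in> A - C. c x} = card {x \<in> A - C. \<not> c x}"
    by (rule balanced_card[OF fAC, of t0]) (use AC_closed t0 c_flip in auto)
  moreover have "card (A - C) = card {x \<in> A - C. c x} + card {x \<in> A - C. \<not> c x}"
  proof -
    have "finite {x \<in> A - C. c x}" "finite {x \<in> A - C. \<not> c x}"
      by (rule finite_subset[OF _ fAC]; auto)+
    then have "card ({x \<in> A - C. c x} \<union> {x \<in> A - C. \<not> c x}) = card {x \<in> A - C. c x} + card {x \<in> A - C. \<not> c x}"
      by (rule card_Un_disjoint) auto
    moreover have "{x \<in> A - C. c x} \<union> {x \<in> A - C. \<not> c x} = A - C" by auto
    ultimately show ?thesis by simp
  qed
  moreover have "{x \<in> A - C. c x} = D \<inter> (A - C)" using A_in by (auto simp: D_def)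
  ultimately show ?thesis by simp
qed

text \<open>Sides from \<open>A - C\<close> are glued among themselves in pairs, while a spike is
  one edge with both of its sides.\<close>

lemma card_surf_edges: "2 * card (surf_edges surf) = card (D \<inter> (A - C)) + 2 * card (D - (A - C))"
proof -
  have "card (enc ` X) = 2 * card (surf_edges surf)"
    unfolding surf_edges_def surf_simps(1)
    by (rule card_fixpoint_free_involution) (use finite_X gl_in gl_gl gl_neq in auto)
  moreover have "card (enc ` X) = card X"
    using enc by (intro card_image) (auto simp: inj_on_def)
  moreover have "X = (D \<inter> (A - C)) \<times> {False} \<union> (D - (A - C)) \<times> UNIV" by (auto simp: X_def)
  then have "card X = card ((D \<inter> (A - C)) \<times> {False}) + card ((D - (A - C)) \<times> (UNIV :: bool set))"
    using finite_D by (simp only:, intro card_Un_disjoint) auto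
  ultimately show ?thesis by (simp add: card_cartesian_product)
qed

text \<open>Tips and spikes cancel. What remains is the number of classes of \<open>bd C\<close>,
  minus the edges of \<open>A - C\<close>, plus the classes of \<open>bd A\<close>. By the second
  assumption the edges of \<open>C\<close> restore the original number of vertices, giving
  \<open>V - |A| + F\<close>, which is \<open>2 - eg A\<close> for a connected ribbon graph.\<close>

lemma euler_surf:
  assumes "eg A = 0" "card (\<Psi> // bd C) + card C div 4 = card (\<Psi> // bd {})"
  shows "euler_char surf = 2"
proof -
  obtain x0 where "x0 \<in> \<Psi>" using nonempty by blast
  then have "cc A `` {x} = cc A `` {x0}" if "x \<in> \<Psi>" for x
    using connected[OF that] eq_equiv_class_iff[OF equiv_cc[OF A]] by simp
  then have "\<Psi> // cc A = {cc A `` {x0}}"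
    using \<open>x0 \<in> \<Psi>\<close> unfolding quotient_def by blast
  then have k: "card (\<Psi> // cc A) = 1" by simp
  have "4 * (card A div 4) = card A" "4 * (card C div 4) = card C"
    using four_dvd_card_edges A C by auto
  moreover have "card (A - C) + card C = card A"
    using card_Diff_subset[OF finite_edges[OF C] CA] card_mono[OF finite_edges[OF A] CA] by simp
  ultimately show ?thesis
    using assms k card_AC card_surf_edges card_vertices card_faces unfolding euler_char_def eg_def by linarith
qed

lemma drawn_surf:
  fixes H :: "'a pair_pre_digraph"
  assumes lab: "\<And>x y. x \<in> \<Psi> \<Longrightarrow> y \<in> \<Psi> \<Longrightarrow> (x, y) \<in> bd C \<longleftrightarrow> lab x = lab y"
    and "lab ` \<Psi> = pverts H"
    and arcs: "\<And>u v. (u, v) \<in> parcs H \<Longrightarrow> \<exists>x \<in> A - C. lab x = u \<and> lab (t0 x) = v"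
  shows "drawn_in (with_proj H) surf"
proof -
  define \<phi> where "\<phi> u = vertex_at surf (enc (rep (inv_into \<Psi> lab u), False))" for u
  have pick: "inv_into \<Psi> lab u \<in> \<Psi>" "lab (inv_into \<Psi> lab u) = u" if "u \<in> pverts H" for u
    using that assms(2) by (auto simp: inv_into_into f_inv_into_f)
  have lab_rep: "lab (rep x) = lab x" if "x \<in> \<Psi>" for x
    using lab[of "rep x" x] rep_bd(1)[of x C] that rep_in(1)[OF that] by (auto simp: D_def)
  have vert: "vertex_at surf (enc (p, False)) = vertex_at surf (enc (q, False)) \<longleftrightarrow> lab p = lab q"
    if "p \<in> D" "q \<in> D" for p q
  proof -
    have "(p, False) \<in> X" "(q, False) \<in> X" using that by (auto simp: X_def)
    then show ?thesis
      using that lab[of p q] eq_equiv_class_iff[OF equiv_bd[OF C]] by (simp add: vertex_at_surf vtx_def D_def)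
  qed
  have \<phi>: "vertex_at surf (enc (p, False)) = \<phi> (lab p)" if "p \<in> D" for p
  proof -
    have "lab p \<in> pverts H" using that assms(2) by (auto simp: D_def)
    from pick[OF this] show ?thesis
      unfolding \<phi>_def using vert[OF that rep_in(1)] lab_rep by simp
  qed
  have "inj_on \<phi> (pverts H)"
  proof (rule inj_onI)
    fix u v assume uv: "u \<in> pverts H" "v \<in> pverts H" "\<phi> u = \<phi> v"
    then show "u = v"
      unfolding \<phi>_def using vert[OF rep_in(1) rep_in(1)] lab_rep pick by metis
  qed
  moreover have "\<phi> ` pverts H \<subseteq> surf_vertices surf"
    unfolding surf_vertices_def \<phi>_def using pick rep_in(2) by auto
  moreover have "\<exists>d \<in> sides surf. {\<phi> u, \<phi> v} = {vertex_at surf d, vertex_at surf (succ_side surf d)}"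
    if uv: "(u, v) \<in> parcs H" for u v
  proof -
    obtain x where x: "x \<in> A - C" "lab x = u" "lab (t0 x) = v" using arcs[OF uv] by blast
    have in\<Psi>: "y \<in> \<Psi>" if "y \<in> A - C" for y using that A_in by blast
    have bdC: "lab (t2 y) = lab y" if "y \<in> A - C" for y
    proof -
      have "(y, tw C y) \<in> bd C" by (rule bd_step)
      then show ?thesis using lab[of y "t2 y"] that in\<Psi> AC_closed by (auto simp: twist_def)
    qed
    have bd1: "lab (t1 y) = lab y" if "y \<in> \<Psi>" for y
    proof -
      have "(y, t1 y) \<in> bd C" by (rule bd_step)
      then show ?thesis using lab[of y "t1 y"] that \<Psi> by auto
    qed
    \<comment> \<open>Of the two flags at this end of the edge the coloured one is a side of the
      surface; \<open>t2\<close> does not change the labels of the ends.\<close>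
    define p where "p = (if c x then x else t2 x)"
    have p: "p \<in> A - C" "lab p = u" "lab (t0 p) = v"
      using x bdC[of x] bdC[of "t0 x"] AC_closed by (auto simp: p_def comm)
    have "p \<in> D" using x c_flip in\<Psi> AC_closed by (auto simp: p_def D_def)
    then have X: "(p, False) \<in> X" by (simp add: X_def)
    have sc: "sc (p, False) = (t1 (t0 p), False)" using p by (auto simp: sc_def twist_def)
    then have "t1 (t0 p) \<in> D" using sc_in[OF X] by (simp add: X_def)
    moreover have "lab (t1 (t0 p)) = v" using bd1[of "t0 p"] in\<Psi> AC_closed(1) p by simp
    ultimately have "{\<phi> u, \<phi> v} = {vertex_at surf (enc (p, False)), vertex_at surf (succ_side surf (enc (p, False)))}"
      using \<phi>[of p] \<phi>[of "t1 (t0 p)"] \<open>p \<in> D\<close> p X sc by simp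
    then show ?thesis using X by auto
  qed
  ultimately show ?thesis unfolding drawn_in_def by (intro exI[of _ \<phi>]) auto
qed

end

section \<open>Additivity of the Euler genus\<close>

lemma conn_on_eq:
  assumes "\<And>f x. f \<in> fs \<Longrightarrow> x \<in> X \<Longrightarrow> f x \<in> X"
    and "\<And>f. f \<in> fs \<Longrightarrow> \<exists>g \<in> gs. \<forall>x \<in> X. g x = f x"
    and "\<And>g. g \<in> gs \<Longrightarrow> \<exists>f \<in> fs. \<forall>x \<in> X. g x = f x"
    and "x \<in> X"
  shows "(x, y) \<in> conn fs \<longleftrightarrow> (x, y) \<in> conn gs"
proof
  assume "(x, y) \<in> conn fs"
  then have "y \<in> X \<and> (x, y) \<in> conn gs"
  proof (induction rule: conn_induct)
    case (step f y)
    then obtain g where "g \<in> gs" "g y = f y" using assms(2) by blast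
    then show ?case using step assms(1) conn_step[of g gs x y] by auto
  qed (use assms in simp)
  then show "(x, y) \<in> conn gs" by simp
next
  assume "(x, y) \<in> conn gs"
  then have "y \<in> X \<and> (x, y) \<in> conn fs"
  proof (induction rule: conn_induct)
    case (step g y)
    then obtain f where "f \<in> fs" "g y = f y" using assms(3) by blast
    then show ?case using step assms(1) conn_step[of f fs x y] by auto
  qed (use assms in simp)
  then show "(x, y) \<in> conn fs" by simp
qed

context ribbon
begin

lemma split_relations:
  assumes A: "edges A" and X: "X \<subseteq> \<Psi>" "\<And>x. x \<in> X \<Longrightarrow> t1 x \<in> X" "\<And>x. x \<in> X \<Longrightarrow> t2 x \<in> X"
    and AX: "\<And>x. x \<in> A \<Longrightarrow> x \<in> X \<Longrightarrow> t0 x \<in> X" and "x \<in> X"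
  shows "(x, y) \<in> bd A \<longleftrightarrow> (x, y) \<in> bd (A \<inter> X)" "(x, y) \<in> cc A \<longleftrightarrow> (x, y) \<in> cc (A \<inter> X)"
    "(x, y) \<in> bd A \<Longrightarrow> y \<in> X" "(x, y) \<in> cc A \<Longrightarrow> y \<in> X"
proof -
  show "(x, y) \<in> bd A \<longleftrightarrow> (x, y) \<in> bd (A \<inter> X)"
    unfolding bd_def by (rule conn_on_eq[of _ X]) (use X AX \<open>x \<in> X\<close> in \<open>auto simp: twist_def\<close>)
  show "(x, y) \<in> cc A \<longleftrightarrow> (x, y) \<in> cc (A \<inter> X)"
    unfolding cc_def by (rule conn_on_eq[of _ X]) (use X AX \<open>x \<in> X\<close> in \<open>auto split: if_splits\<close>)
  show "(x, y) \<in> bd A \<Longrightarrow> y \<in> X"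
    unfolding bd_def by (erule conn_closed[OF _ \<open>x \<in> X\<close>]) (use X AX in \<open>auto simp: twist_def\<close>)
  show "(x, y) \<in> cc A \<Longrightarrow> y \<in> X"
    unfolding cc_def by (erule conn_closed[OF _ \<open>x \<in> X\<close>]) (use X AX in \<open>auto split: if_splits\<close>)
qed

text \<open>The relations \<open>bd\<close> and \<open>cc\<close> do not depend on the set of flags
  that is counted. As no edge of \<open>A\<close> leaves \<open>X\<close>, no class meets both
  \<open>X\<close> and its complement, and all four counts are sums.\<close>

lemma eg_split:
  assumes A: "edges A" and X: "X \<subseteq> \<Psi>" "\<And>x. x \<in> X \<Longrightarrow> t1 x \<in> X" "\<And>x. x \<in> X \<Longrightarrow> t2 x \<in> X"
    and AX: "\<And>x. x \<in> A \<Longrightarrow> x \<in> X \<Longrightarrow> t0 x \<in> X"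
  shows "eg A = ribbon.eg t0 t1 t2 X (A \<inter> X) + ribbon.eg t0 t1 t2 (\<Psi> - X) (A - X)"
proof -
  have t: "t0 x \<in> A \<longleftrightarrow> x \<in> A" "t2 x \<in> A \<longleftrightarrow> x \<in> A" for x
    using A t0 t2 unfolding edges_def by metis+
  have t': "t0 x \<in> X \<longleftrightarrow> x \<in> X" if "x \<in> A" for x using AX t t0 that by metis
  have t'': "t1 x \<in> X \<longleftrightarrow> x \<in> X" "t2 x \<in> X \<longleftrightarrow> x \<in> X" for x using X t1 t2 by metis+
  let ?Y = "\<Psi> - X"
  have AX': "edges (A \<inter> X)" "edges (A - X)"
    using A t t' t'' unfolding edges_def by auto
  have A_sub: "A \<subseteq> A0" "A0 \<subseteq> \<Psi>" using A A0 by (auto simp: edges_def)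
  have Y: "?Y \<subseteq> \<Psi>" "\<And>x. x \<in> ?Y \<Longrightarrow> t1 x \<in> ?Y" "\<And>x. x \<in> ?Y \<Longrightarrow> t2 x \<in> ?Y"
    using \<Psi> t'' by auto
  have AY: "\<And>x. x \<in> A \<Longrightarrow> x \<in> ?Y \<Longrightarrow> t0 x \<in> ?Y" using t t' A_sub by blast
  have AYeq: "A \<inter> ?Y = A - X" using A_sub by blast
  interpret R1: ribbon t0 t1 t2 X "A \<inter> X"
    by unfold_locales
      (use t0 t1 t2 comm t02 A_sub X t t' t'' finite_subset[OF X(1) fin] in auto)
  interpret R2: ribbon t0 t1 t2 ?Y "A - X"
    by unfold_locales
      (use t0 t1 t2 comm t02 A_sub Y t t' t'' fin in auto)
  have un: "\<Psi> = X \<union> ?Y" using X by blast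
  have fins: "finite X" "finite ?Y" using finite_subset[OF X(1) fin] fin by auto
  note SX = split_relations[OF A X AX] and SY = split_relations[OF A Y AY, unfolded AYeq]
  have bdA: "card (\<Psi> // bd A) = card (X // bd (A \<inter> X)) + card (?Y // bd (A - X))"
  proof -
    have "card ((X \<union> ?Y) // bd A) = card (X // bd A) + card (?Y // bd A)"
      by (rule card_quotient_Un[OF equiv_bd[OF A] fins]) (use SX(3) in blast)
    then show ?thesis
      using un card_quotient_cong[of X "bd A" "bd (A \<inter> X)"] card_quotient_cong[of ?Y "bd A" "bd (A - X)"]
        SX(1) SY(1) by simp
  qed
  have ccA: "card (\<Psi> // cc A) = card (X // cc (A \<inter> X)) + card (?Y // cc (A - X))"
  proof -
    have "card ((X \<union> ?Y) // cc A) = card (X // cc A) + card (?Y // cc A)"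
      by (rule card_quotient_Un[OF equiv_cc[OF A] fins]) (use SX(4) in blast)
    then show ?thesis
      using un card_quotient_cong[of X "cc A" "cc (A \<inter> X)"] card_quotient_cong[of ?Y "cc A" "cc (A - X)"]
        SX(2) SY(2) by simp
  qed
  have bd0: "card (\<Psi> // bd {}) = card (X // bd {}) + card (?Y // bd {})"
  proof -
    have "card ((X \<union> ?Y) // bd {}) = card (X // bd {}) + card (?Y // bd {})"
      by (rule card_quotient_Un[OF equiv_bd[OF edges_empty] fins])
        (use split_relations(3)[OF edges_empty X] in blast)
    then show ?thesis using un by simp
  qed
  have "card A = card (A \<inter> X) + card (A - X)"
    using finite_edges[OF A] by (metis card_Int_Diff)
  then have "card A div 4 = card (A \<inter> X) div 4 + card (A - X) div 4"
    using four_dvd_card_edges[OF AX'(1)] by (simp add: div_plus_div_distrib_dvd_left)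
  then show ?thesis
    using bdA ccA bd0 unfolding eg_def R1.eg_def R2.eg_def by linarith
qed

end

section \<open>The flags of a closed surface\<close>

locale gluing_flags =
  fixes S :: "'d gluing"
  assumes S: "closed_surface S"
begin

abbreviation "nx \<equiv> succ_side S"

definition "flags = sides S \<times> (UNIV :: bool set)"

definition f0 :: "'d \<times> bool \<Rightarrow> 'd \<times> bool" where "f0 = (\<lambda>(d, b). (d, \<not> b))"
definition f1 :: "'d \<times> bool \<Rightarrow> 'd \<times> bool" where
  "f1 = (\<lambda>(d, b). if b then (inv nx d, False) else (nx d, True))"
text \<open>The flag on the other side of the edge at the same end, so a parallel gluing keeps the
  mark for start or end. Outside the sides the value is chosen so that \<open>f2\<close> is a
  fixpoint-free involution commuting with \<open>f0\<close> on the whole type, as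
  \<open>ribbon\<close> requires.\<close>

definition f2 :: "'d \<times> bool \<Rightarrow> 'd \<times> bool" where
  "f2 = (\<lambda>(d, b). if d \<in> sides S then (glue S d, if parallel S d then b else \<not> b) else (d, \<not> b))"

text \<open>The flag \<open>(d, True)\<close> lies at the start of the side \<open>d\<close>, and \<open>(d, False)\<close> at its end, which is
  the start of \<open>nx d\<close>.\<close>

definition corner :: "'d \<times> bool \<Rightarrow> 'd" where "corner = (\<lambda>(d, b). if b then d else nx d)"

definition "vl f = vertex_at S (corner f)"

lemma fin_sides: "finite (sides S)" and nx: "nx permutes sides S"
  and glue: "d \<in> sides S \<Longrightarrow> glue S d \<in> sides S" "d \<in> sides S \<Longrightarrow> glue S d \<noteq> d"
    "d \<in> sides S \<Longrightarrow> glue S (glue S d) = d" "d \<in> sides S \<Longrightarrow> parallel S (glue S d) = parallel S d"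
  using S by (auto simp: closed_surface_def)

lemma permutation_nx: "permutation nx"
  using nx fin_sides by (auto simp: permutation_permutes)

lemma nx_inv [simp]: "nx (inv nx d) = d" "inv nx (nx d) = d"
  using permutes_inverses[OF nx] by auto

lemma nx_in [simp]: "nx d \<in> sides S \<longleftrightarrow> d \<in> sides S" "inv nx d \<in> sides S \<longleftrightarrow> d \<in> sides S"
  using permutes_in_image[OF nx] permutes_in_image[OF permutes_inv[OF nx]] by auto

sublocale ribbon f0 f1 f2 flags flags
  by unfold_locales
    (use fin_sides glue glue(2)[symmetric] in \<open>auto simp: flags_def f0_def f1_def f2_def split: if_splits\<close>)

lemma corner_f1: "corner (f1 x) = corner x"
  by (cases x) (auto simp: corner_def f1_def)

lemma corner_f2:
  assumes "x \<in> flags"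
  shows "(corner x, corner (f2 x)) \<in> symcl (corner_rel S)"
proof -
  obtain d b where x: "x = (d, b)" "d \<in> sides S" using assms by (auto simp: flags_def)
  have "(d, nx (glue S d)) \<in> corner_rel S" "(glue S d, nx d) \<in> corner_rel S" if "\<not> parallel S d"
    using that x glue[of d] by (force simp: corner_rel_def)+
  moreover have "(d, glue S d) \<in> corner_rel S" "(nx d, nx (glue S d)) \<in> corner_rel S" if "parallel S d"
    using that x glue[of d] by (force simp: corner_rel_def)+
  ultimately show ?thesis
    using x by (auto simp: corner_def f2_def symcl_def)
qed

text \<open>\<open>f1\<close> stays at a corner and \<open>f2\<close> moves between corners
  identified by \<open>corner_rel\<close>; conversely each of the three kinds of pairs in
  \<open>corner_rel\<close> is a composition of such moves.\<close>

lemma vl_eq_iff: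
  assumes "x \<in> flags" "y \<in> flags"
  shows "(x, y) \<in> bd {} \<longleftrightarrow> vl x = vl y"
proof
  assume "(x, y) \<in> bd {}"
  then have "y \<in> flags \<and> (corner x, corner y) \<in> (symcl (corner_rel S))\<^sup>*"
    unfolding bd_empty
  proof (induction rule: conn_induct)
    case (step f y)
    then consider "f = f1" | "f = f2" by auto
    then show ?case
    proof cases
      case 1
      then show ?thesis using step.IH \<Psi> corner_f1 by simp
    next
      case 2
      then show ?thesis using step.IH \<Psi> corner_f2 by (meson rtrancl_into_rtrancl)
    qed
  qed (use assms in simp)
  then show "vl x = vl y" by (simp add: vl_def vertex_at_eq_iff)
next
  note E = equiv_UNIV_D[OF equiv_bd[OF edges_empty]]
  have step1: "(x, f1 x) \<in> bd {}" "(x, f2 x) \<in> bd {}" for x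
    unfolding bd_empty by (auto intro: conn_step)
  have base: "(x, (corner x, True)) \<in> bd {}" for x
    using E(1) step1(1)[of x] by (cases x) (auto simp: corner_def f1_def)
  have cr: "((d, True), (e, True)) \<in> bd {}" if "(d, e) \<in> corner_rel S" for d e
  proof -
    have parT: "((d, True), (glue S d, True)) \<in> bd {}" "((d, False), (glue S d, False)) \<in> bd {}"
      if "d \<in> sides S" "parallel S d" for d
      using step1(2)[of "(d, True)"] step1(2)[of "(d, False)"] that by (simp_all add: f2_def)
    have npar: "((d, True), (glue S d, False)) \<in> bd {}" if "d \<in> sides S" "\<not> parallel S d" for d
      using step1(2)[of "(d, True)"] that by (simp add: f2_def)
    have nxt: "((d, False), (nx d, True)) \<in> bd {}" for d using base[of "(d, False)"] by (simp add: corner_def)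
    from that consider "d \<in> sides S" "\<not> parallel S d" "e = nx (glue S d)"
      | "d \<in> sides S" "parallel S d" "e = glue S d"
      | a where "a \<in> sides S" "parallel S a" "d = nx a" "e = nx (glue S a)"
      unfolding corner_rel_def by blast
    then show ?thesis
    proof cases
      case 1
      then show ?thesis using E(3)[OF npar nxt] by simp
    next
      case 2
      then show ?thesis using parT by simp
    next
      case 3
      then show ?thesis using E(3)[OF E(3)[OF E(2)[OF nxt] parT(2)] nxt] by simp
    qed
  qed
  assume "vl x = vl y"
  then have "(corner x, corner y) \<in> (symcl (corner_rel S))\<^sup>*" by (simp add: vl_def vertex_at_eq_iff)
  then have "((corner x, True), (corner y, True)) \<in> bd {}"
  proof (induction rule: rtrancl_induct)
    case base
    show ?case by (rule E(1))
  next
    case (step d e)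
    then have "(d, e) \<in> corner_rel S \<or> (e, d) \<in> corner_rel S" by (auto simp: symcl_def)
    then have "((d, True), (e, True)) \<in> bd {}" using cr E(2) by blast
    then show ?case using step.IH E(3) by blast
  qed
  then show "(x, y) \<in> bd {}" using base E(2,3) by blast
qed

lemma vl_image: "vl ` flags = surf_vertices S"
proof
  show "vl ` flags \<subseteq> surf_vertices S"
    by (auto simp: vl_def corner_def flags_def surf_vertices_def)
  show "surf_vertices S \<subseteq> vl ` flags"
    by (force simp: vl_def corner_def flags_def surf_vertices_def image_iff)
qed

lemma vl_f1: "x \<in> flags \<Longrightarrow> vl (f1 x) = vl x" and vl_f2: "x \<in> flags \<Longrightarrow> vl (f2 x) = vl x"
proof -
  assume x: "x \<in> flags"
  have "(x, f1 x) \<in> bd {}" "(x, f2 x) \<in> bd {}" unfolding bd_empty by (auto intro: conn_step)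
  then show "vl (f1 x) = vl x" "vl (f2 x) = vl x" using vl_eq_iff x \<Psi> by auto
qed

lemma edges_flags: "edges flags"
  using A0_closed by (simp add: edges_def)

lemma tw_flags: "x \<in> flags \<Longrightarrow> tw flags x = f0 x"
  by (simp add: twist_def)

lemma bd_flags_side: "d \<in> sides S \<Longrightarrow> ((d, b), (d, b')) \<in> bd flags"
  using bd_step(2)[of "(d, b)" flags] equiv_UNIV_D(1)[OF equiv_bd[OF edges_flags]]
  by (cases "b = b'") (auto simp: twist_def flags_def f0_def)

lemma bd_flags_nx: "d \<in> sides S \<Longrightarrow> ((d, True), (nx d, True)) \<in> bd flags"
  using bd_flags_side[of d True False] bd_step(1)[of "(d, False)" flags]
    equiv_UNIV_D(3)[OF equiv_bd[OF edges_flags]] by (fastforce simp: f1_def)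

text \<open>When every edge is present, a boundary walk stays in one polygon: \<open>f0\<close> runs
  along a side and \<open>f1\<close> turns the corner to the neighbouring side.\<close>

lemma bd_flags_iff:
  assumes "x \<in> flags" "y \<in> flags"
  shows "(x, y) \<in> bd flags \<longleftrightarrow> orbit nx (fst x) = orbit nx (fst y)"
proof
  have step: "orbit nx (nx d) = orbit nx d" "orbit nx (inv nx d) = orbit nx d" for d
    using permutation_orbit_step[OF permutation_nx, of d]
      permutation_orbit_step[OF permutation_nx, of "inv nx d"] by simp_all
  assume "(x, y) \<in> bd flags"
  then have "y \<in> flags \<and> orbit nx (fst x) = orbit nx (fst y)"
    unfolding bd_def
  proof (induction rule: conn_induct)
    case (step f y)
    then consider "f = f1" | "f = tw flags" by auto
    then show ?case
    proof cases
      case 1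
      then show ?thesis using step.IH \<Psi>(1)[of y] \<open>\<And>d. orbit nx (nx d) = orbit nx d\<close>
          \<open>\<And>d. orbit nx (inv nx d) = orbit nx d\<close> by (cases y) (simp add: f1_def)
    next
      case 2
      then show ?thesis using step.IH tw_flags A0_closed(1)[of y] by (cases y) (simp add: f0_def)
    qed
  qed (use assms in simp)
  then show "orbit nx (fst x) = orbit nx (fst y)" by simp
next
  note E = equiv_UNIV_D[OF equiv_bd[OF edges_flags]]
  assume eq: "orbit nx (fst x) = orbit nx (fst y)"
  have sides: "fst x \<in> sides S" "fst y \<in> sides S" using assms by (auto simp: flags_def)
  have "fst y \<in> orbit nx (fst x)" using permutation_self_in_orbit[OF permutation_nx] eq by simp
  then have "fst y \<in> sides S \<and> ((fst x, True), (fst y, True)) \<in> bd flags"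
  proof (induction rule: orbit.induct)
    case base
    show ?case using sides bd_flags_nx by simp
  next
    case (step d)
    then show ?case using bd_flags_nx[of d] E(3) by auto
  qed
  moreover have "(x, (fst x, True)) \<in> bd flags" "((fst y, True), y) \<in> bd flags"
    using bd_flags_side[OF sides(1), of "snd x" True] bd_flags_side[OF sides(2), of True "snd y"] by simp_all
  ultimately show "(x, y) \<in> bd flags" using E(3) by blast
qed

lemma cc_flags:
  assumes "x \<in> flags" "y \<in> flags"
  shows "(x, y) \<in> cc flags"
proof -
  note E = equiv_UNIV_D[OF equiv_cc[OF edges_flags]]
  note sub = subsetD[OF bd_le_cc[OF edges_flags]]
  have sides: "fst x \<in> sides S" "fst y \<in> sides S" using assms by (auto simp: flags_def)
  then have "(fst x, fst y) \<in> ({(a, nx a) | a. a \<in> sides S} \<union> {(a, glue S a) | a. a \<in> sides S})\<^sup>*"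
    using S unfolding closed_surface_def by blast
  then have "((fst x, True), (fst y, True)) \<in> cc flags"
  proof (induction rule: rtrancl_induct)
    case base
    show ?case by (rule E(1))
  next
    case (step d e)
    have "((d, True), (e, True)) \<in> cc flags"
    proof -
      consider "d \<in> sides S" "e = nx d" | "d \<in> sides S" "e = glue S d" using step.hyps(2) by blast
      then show ?thesis
      proof cases
        case 1
        then show ?thesis using sub[OF bd_flags_nx] by simp
      next
        case 2
        obtain b where "f2 (d, True) = (e, b)" using 2 by (auto simp: f2_def)
        then have "((d, True), (e, b)) \<in> cc flags" using cc_step(2)[of "(d, True)" flags] by simp
        then show ?thesis using sub[OF bd_flags_side[of e b True]] 2 glue(1)[of d] E(3) by blast
      qed
    qed
    then show ?case using step.IH E(3) by blast
  qed
  moreover have "(x, (fst x, True)) \<in> cc flags" "((fst y, True), y) \<in> cc flags"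
    using sub[OF bd_flags_side[OF sides(1), of "snd x" True]]
      sub[OF bd_flags_side[OF sides(2), of True "snd y"]] by simp_all
  ultimately show ?thesis using E(3) by blast
qed

lemma eg_flags: "eg flags = 2 - euler_char S"
proof -
  have "card (flags // bd {}) = card (surf_vertices S)"
    using card_quotient_labels[OF vl_eq_iff equiv_bd[OF edges_empty]] vl_image by simp
  moreover have "card (flags // bd flags) = card ((\<lambda>x. orbit nx (fst x)) ` flags)"
    by (rule card_quotient_labels[OF bd_flags_iff equiv_bd[OF edges_flags]])
  moreover have "(\<lambda>x. orbit nx (fst x)) ` flags = surf_faces S"
    by (force simp: flags_def surf_faces_def image_iff)
  moreover have "card (flags // cc flags) = 1"
  proof -
    have "sides S \<noteq> {}" using S by (simp add: closed_surface_def)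
    then obtain x where x: "x \<in> flags" by (auto simp: flags_def)
    have "cc flags `` {y} = cc flags `` {x}" if "y \<in> flags" for y
      using cc_flags[OF that x] eq_equiv_class_iff[OF equiv_cc[OF edges_flags]] by simp
    then have "flags // cc flags = {cc flags `` {x}}" using x unfolding quotient_def by blast
    then show ?thesis by simp
  qed
  moreover have "card flags = 4 * card (surf_edges S)"
  proof -
    have "card (sides S) = 2 * card (surf_edges S)"
      unfolding surf_edges_def by (rule card_fixpoint_free_involution[OF fin_sides]) (use glue in auto)
    then show ?thesis by (simp add: flags_def card_cartesian_product)
  qed
  ultimately show ?thesis unfolding eg_def euler_char_def by simp
qed

lemma colouring_if_orientable:
  assumes "orientable S"
  shows "\<exists>c. colouring flags c"
proof -
  obtain keep :: "'d \<Rightarrow> bool" where "\<forall>d \<in> sides S. keep (nx d) = keep d \<and> (keep (glue S d) = keep d) = (\<not> parallel S d)"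
    using assms unfolding orientable_def by blast
  then have keep: "keep (nx d) = keep d" "keep (glue S d) = keep d \<longleftrightarrow> \<not> parallel S d"
    if "d \<in> sides S" for d using that by simp_all
  have "keep (inv nx d) = keep d" if "d \<in> sides S" for d
    using keep(1)[of "inv nx d"] that by simp
  \<comment> \<open>A flag is coloured when it lies at the start of its side in the direction chosen
    by \<open>keep\<close>.\<close>
  then have "colouring flags (\<lambda>(d, b). keep d = b)"
    using keep unfolding colouring_def by (auto simp: flags_def f0_def f1_def f2_def)
  then show ?thesis by blast
qed

section \<open>Subgraphs of the 1-skeleton induced on sets of points\<close>

definition "region U = {x \<in> flags. vl x \<in> U}"

text \<open>\<open>inner U\<close> consists of the edges of the induced ribbon graph, those with
  both ends in \<open>U\<close>. The flags of its vertices form \<open>region U\<close>, which edges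
  leaving \<open>U\<close> keep from being closed under \<open>f0\<close>.\<close>

definition "inner U = {x \<in> region U. f0 x \<in> region U}"

lemma region_flags: "x \<in> region U \<Longrightarrow> x \<in> flags" and inner_region: "x \<in> inner U \<Longrightarrow> x \<in> region U"
  by (auto simp: region_def inner_def)

lemma region_closed [simp]: "x \<in> flags \<Longrightarrow> f1 x \<in> region U \<longleftrightarrow> x \<in> region U"
    "x \<in> flags \<Longrightarrow> f2 x \<in> region U \<longleftrightarrow> x \<in> region U"
  using vl_f1 vl_f2 \<Psi> by (auto simp: region_def)

lemma inner_closed: "x \<in> inner U \<Longrightarrow> f0 x \<in> inner U" "x \<in> inner U \<Longrightarrow> f2 x \<in> inner U"
proof -
  assume x: "x \<in> inner U"
  then show "f0 x \<in> inner U" using t0 by (simp add: inner_def)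
  have "x \<in> flags" "f0 x \<in> flags" using x by (auto simp: inner_def region_def)
  then show "f2 x \<in> inner U" using x by (simp add: inner_def comm)
qed

lemma ribbon_region:
  assumes "W \<subseteq> flags" "\<And>x. x \<in> W \<Longrightarrow> f1 x \<in> W" "\<And>x. x \<in> W \<Longrightarrow> f2 x \<in> W"
    and "A \<subseteq> W" "\<And>x. x \<in> A \<Longrightarrow> f0 x \<in> A" "\<And>x. x \<in> A \<Longrightarrow> f2 x \<in> A"
  shows "ribbon f0 f1 f2 W A"
proof
  show "f0 x \<noteq> f2 x" if "x \<in> A" for x using t02 that assms(1,4) by blast
  show "finite W" using assms(1) fin by (rule finite_subset)
qed (use t0 t1 t2 comm assms in auto)

text \<open>Deleting all edges that are not inside one of the three sets does not increase the Euler
  genus. The regions are then split off one by one, and the rest has no edges and Euler genus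
  0.\<close>

lemma eg_three_regions:
  assumes "U \<inter> V = {}" "U \<inter> W = {}" "V \<inter> W = {}"
  shows "ribbon.eg f0 f1 f2 (region U) (inner U) + ribbon.eg f0 f1 f2 (region V) (inner V)
    + ribbon.eg f0 f1 f2 (region W) (inner W) \<le> eg flags"
proof -
  define A where "A = inner U \<union> inner V \<union> inner W"
  have disj: "region U \<inter> region V = {}" "region U \<inter> region W = {}" "region V \<inter> region W = {}"
    using assms by (auto simp: region_def)
  have sub: "inner X \<subseteq> region X" "region X \<subseteq> flags" for X
    by (auto simp: inner_def region_def)
  have A: "edges A" using inner_closed sub unfolding edges_def A_def by blast
  have "eg A \<le> eg flags" by (rule eg_mono[OF A edges_flags]) (use A in \<open>simp add: edges_def\<close>)
  have in_flags: "x \<in> flags" if "x \<in> region X" for x X using that sub by blast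
  have f1: "f1 x \<in> flags" "f2 x \<in> flags" if "x \<in> flags" for x using that \<Psi> by auto
  have split1: "eg A = ribbon.eg f0 f1 f2 (region U) (inner U)
      + ribbon.eg f0 f1 f2 (flags - region U) (inner V \<union> inner W)"
  proof -
    have "A \<inter> region U = inner U" "A - region U = inner V \<union> inner W"
      using disj sub unfolding A_def by blast+
    moreover have "eg A = ribbon.eg f0 f1 f2 (region U) (A \<inter> region U)
      + ribbon.eg f0 f1 f2 (flags - region U) (A - region U)"
    proof (rule eg_split[OF A sub(2)])
      fix x assume "x \<in> A" "x \<in> region U"
      then have "x \<in> inner U" using \<open>A \<inter> region U = inner U\<close> by blast
      then show "f0 x \<in> region U" using inner_closed sub by blast
    qed (use in_flags in auto)
    ultimately show ?thesis by simp
  qed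
  have "inner V \<union> inner W \<subseteq> flags - region U" using sub disj by blast
  then interpret R2: ribbon f0 f1 f2 "flags - region U" "inner V \<union> inner W"
    by (intro ribbon_region) (use f1 inner_closed in auto)
  have e2: "R2.edges (inner V \<union> inner W)"
    using inner_closed unfolding R2.edges_def by blast
  have split2: "R2.eg (inner V \<union> inner W) = ribbon.eg f0 f1 f2 (region V) (inner V)
      + ribbon.eg f0 f1 f2 (flags - region U - region V) (inner W)"
  proof -
    have eqs: "(inner V \<union> inner W) \<inter> region V = inner V" "(inner V \<union> inner W) - region V = inner W"
      using disj sub by blast+
    moreover have "R2.eg (inner V \<union> inner W) = ribbon.eg f0 f1 f2 (region V) ((inner V \<union> inner W) \<inter> region V)
      + ribbon.eg f0 f1 f2 (flags - region U - region V) ((inner V \<union> inner W) - region V)"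
    proof (rule R2.eg_split[OF e2])
      show "region V \<subseteq> flags - region U" using sub disj by blast
      fix x assume "x \<in> inner V \<union> inner W" "x \<in> region V"
      then have "x \<in> inner V" using eqs by blast
      then show "f0 x \<in> region V" using inner_closed sub by blast
    qed (use in_flags in auto)
    ultimately show ?thesis by simp
  qed
  have "inner W \<subseteq> flags - region U - region V" using sub disj by blast
  then interpret R3: ribbon f0 f1 f2 "flags - region U - region V" "inner W"
    by (intro ribbon_region) (use f1 inner_closed in auto)
  have e3: "R3.edges (inner W)"
    using inner_closed unfolding R3.edges_def by blast
  have split3: "R3.eg (inner W) = ribbon.eg f0 f1 f2 (region W) (inner W)
      + ribbon.eg f0 f1 f2 (flags - region U - region V - region W) {}"
  proof -
    have eqs: "inner W \<inter> region W = inner W" "inner W - region W = {}"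
      using sub by blast+
    moreover have "R3.eg (inner W) = ribbon.eg f0 f1 f2 (region W) (inner W \<inter> region W)
      + ribbon.eg f0 f1 f2 (flags - region U - region V - region W) (inner W - region W)"
    proof (rule R3.eg_split[OF e3])
      show "region W \<subseteq> flags - region U - region V" using sub disj by blast
      fix x assume "x \<in> inner W"
      then show "f0 x \<in> region W" using inner_closed sub by blast
    qed (use in_flags in auto)
    ultimately show ?thesis by (simp only: eqs)
  qed
  interpret R4: ribbon f0 f1 f2 "flags - region U - region V - region W" "{}"
    by (rule ribbon_region) (use f1 in auto)
  show ?thesis
    using \<open>eg A \<le> eg flags\<close> split1 split2 split3 R4.eg_empty by linarith
qed

text \<open>\<open>lab\<close> is the vertex map of a minor: it collapses the path \<open>ws\<close>
  to \<open>z\<close> and is injective elsewhere. Euler genus 0 would give an orientation and hence,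
  by contracting \<open>ws\<close>, a sphere on which \<open>H\<close> is drawn. \<open>enc\<close>
  numbers the sides of that sphere, since \<open>planar\<close> speaks of surfaces on natural
  numbers.\<close>

lemma eg_region_nonplanar:
  fixes H :: "'a pair_pre_digraph" and lab :: "'d set \<Rightarrow> 'a" and enc :: "('d \<times> bool) \<times> bool \<Rightarrow> nat"
  assumes enc: "inj enc"
    and nonplanar: "\<not> planar (with_proj H)"
    and loopfree: "\<And>u. (u, u) \<notin> parcs H"
    and reach: "\<And>u v. u \<in> pverts H \<Longrightarrow> v \<in> pverts H \<Longrightarrow> (u, v) \<in> (parcs H)\<^sup>*"
    and U: "U \<subseteq> surf_vertices S"
    and ws: "ws \<noteq> []" "distinct ws" "set ws \<subseteq> U" "\<And>w. w \<in> set ws \<Longrightarrow> lab w = z"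
    and path: "\<And>i. Suc i < length ws \<Longrightarrow> \<exists>e \<in> inner U. vl e = ws ! i \<and> vl (f0 e) = ws ! Suc i"
    and lab: "inj_on lab (U - set ws)" "z \<notin> lab ` (U - set ws)" "lab ` U = pverts H"
    and arcs: "\<And>u v. (u, v) \<in> parcs H \<Longrightarrow> \<exists>e \<in> inner U. lab (vl e) = u \<and> lab (vl (f0 e)) = v"
  shows "1 \<le> ribbon.eg f0 f1 f2 (region U) (inner U)"
    and "orientable S \<Longrightarrow> 2 \<le> ribbon.eg f0 f1 f2 (region U) (inner U)"
proof -
  have sub: "inner X \<subseteq> region X" "region X \<subseteq> flags" for X
    by (auto simp: inner_def region_def)
  interpret R: ribbon f0 f1 f2 "region U" "inner U"
    by (rule ribbon_region) (use sub inner_closed region_closed region_flags in blast)+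
  have e: "R.edges (inner U)" using inner_closed by (auto simp: R.edges_def)
  have vl_iff: "(x, y) \<in> R.bd {} \<longleftrightarrow> vl x = vl y" if "x \<in> region U" "y \<in> region U" for x y
    using vl_eq_iff that region_flags by blast
  have "R.eg (inner U) \<noteq> 0"
  proof
    assume eg0: "R.eg (inner U) = 0"
    then obtain c where c: "R.colouring (inner U) c" using R.colouring_if_eg_0[OF e] by blast
    obtain C where C: "R.edges C" "vl ` C \<subseteq> set ws"
      "card (region U // R.bd C) + card C div 4 = card (region U // R.bd {})"
      "\<And>x y. x \<in> region U \<Longrightarrow> y \<in> region U \<Longrightarrow>
        (x, y) \<in> R.bd C \<longleftrightarrow> vl x = vl y \<or> vl x \<in> set ws \<and> vl y \<in> set ws"
      using R.contract_path[OF vl_iff ws(1,2) path] by blast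
    have C_sub: "C \<subseteq> inner U" using C(1) by (simp add: R.edges_def)
    \<comment> \<open>The fibres of \<open>lab\<close> on \<open>U\<close> are the set of path
      vertices and single points, exactly the vertices after contraction.\<close>
    have bdC: "(x, y) \<in> R.bd C \<longleftrightarrow> lab (vl x) = lab (vl y)" if "x \<in> region U" "y \<in> region U" for x y
    proof -
      have "vl x \<in> U" "vl y \<in> U" using that by (auto simp: region_def)
      then have "lab (vl x) = lab (vl y) \<longleftrightarrow> vl x = vl y \<or> vl x \<in> set ws \<and> vl y \<in> set ws"
        using ws(4) lab(1,2) by (cases "vl x \<in> set ws"; cases "vl y \<in> set ws")
          (auto simp: inj_on_def image_iff)
      then show ?thesis using C(4)[OF that] by simp
    qed
    have "vl ` region U = U"
    proof -
      have "U \<subseteq> vl ` flags" using U vl_image by simp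
      then show ?thesis by (auto simp: region_def)
    qed
    then have image: "(\<lambda>x. lab (vl x)) ` region U = pverts H" using lab(3) by (simp add: image_image[symmetric])
    interpret T: contracted_ribbon f0 f1 f2 "region U" "inner U" "inner U" C c enc
    proof
      show "region U \<noteq> {}" using \<open>vl ` region U = U\<close> ws(1,3) by (cases ws) auto
      note E = equiv_UNIV_D[OF R.equiv_cc[OF e]]
      have bd_cc: "(x, y) \<in> R.cc (inner U)" if "(x, y) \<in> R.bd C" for x y
      proof -
        have "R.bd C \<subseteq> R.cc (inner U)"
          unfolding R.bd_def[of C]
        proof (rule conn_least[OF R.equiv_cc[OF e]])
          fix x h assume "h \<in> {f1, twist f0 f2 C}"
          then show "(x, h x) \<in> R.cc (inner U)"
            using R.cc_step[of x "inner U"] C_sub by (auto simp: twist_def)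
        qed
        then show ?thesis using that by blast
      qed
      fix x y assume x: "x \<in> region U" and y: "y \<in> region U"
      have "lab (vl x) \<in> pverts H" "lab (vl y) \<in> pverts H" using image x y by blast+
      then have "(lab (vl x), lab (vl y)) \<in> (parcs H)\<^sup>*" by (rule reach)
      \<comment> \<open>Lift a walk of \<open>H\<close>: each arc comes from an edge in
        \<open>inner U\<close>, and flags with equal labels are connected through
        \<open>bd C\<close>.\<close>
      then have "\<forall>w \<in> region U. lab (vl w) = lab (vl y) \<longrightarrow> (x, w) \<in> R.cc (inner U)"
      proof (induction rule: rtrancl_induct)
        case base
        show ?case using bd_cc bdC x by auto
      next
        case (step u v)
        then obtain e where e: "e \<in> inner U" "lab (vl e) = u" "lab (vl (f0 e)) = v" using arcs by blast
        then have "e \<in> region U" "f0 e \<in> region U" using inner_closed inner_region by blast+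
        then have "(x, e) \<in> R.cc (inner U)" using step.IH e by blast
        moreover have "(e, f0 e) \<in> R.cc (inner U)" by (rule R.cc_step(3)[OF e(1)])
        moreover have "(f0 e, w) \<in> R.cc (inner U)" if "w \<in> region U" "lab (vl w) = v" for w
          using bd_cc bdC[OF \<open>f0 e \<in> region U\<close> that(1)] e that by simp
        ultimately show ?case using E(3) by blast
      qed
      then show "(x, y) \<in> R.cc (inner U)" using y by blast
    next
      fix x assume "x \<in> C"
      then have "x \<in> region U" "f2 x \<in> region U" using C_sub inner_closed inner_region by blast+
      then show "(x, f2 x) \<in> R.bd C" using C(4) vl_f2 region_flags by blast
    qed (use e C(1) C_sub c enc in auto)
    have "drawn_in (with_proj H) T.surf"
    proof (rule T.drawn_surf[OF bdC image])
      fix u v assume uv: "(u, v) \<in> parcs H"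
      then obtain e where e: "e \<in> inner U" "lab (vl e) = u" "lab (vl (f0 e)) = v" using arcs by blast
      \<comment> \<open>Both ends of an edge in \<open>C\<close> lie on the path, so such an edge
        would make a loop of \<open>H\<close> at \<open>z\<close>.\<close>
      have "e \<notin> C"
      proof
        assume "e \<in> C"
        moreover from this have "f0 e \<in> C" using C(1) by (simp add: R.edges_def)
        ultimately have "u = v" using C(2) ws(4) e by auto
        then show False using uv loopfree by simp
      qed
      then show "\<exists>x \<in> inner U - C. lab (vl x) = u \<and> lab (vl (f0 x)) = v" using e by blast
    qed
    then have "planar (with_proj H)"
      unfolding planar_def embeds_orientable_def
      using T.surf_closed T.surf_orientable T.euler_surf[OF eg0 C(3)] by (intro exI[of _ T.surf]) simp
    then show False using nonplanar by blast
  qed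
  then show "1 \<le> R.eg (inner U)" using R.eg_nonneg[OF e] by linarith
  moreover assume "orientable S"
  then obtain c where "colouring flags c" using colouring_if_orientable by blast
  then have "R.colouring (inner U) c"
    using sub unfolding R.colouring_def colouring_def by blast
  then have "even (R.eg (inner U))" using R.even_eg[OF e] by blast
  ultimately show "2 \<le> R.eg (inner U)" by presburger
qed

end

section \<open>The graph of the theorem\<close>

lemma reachable_if_k_connected:
  fixes H :: "'a pair_pre_digraph"
  assumes "pair_graph H" "k_connected k (with_proj H)" "0 < k" "u \<in> pverts H" "v \<in> pverts H"
  shows "(u, v) \<in> (parcs H)\<^sup>*"
proof -
  interpret pair_graph H by fact
  let ?G = "with_proj H \<restriction> (verts (with_proj H) - {})"
  have "Digraph_Component.connected ?G"
    using assms(2,3) unfolding k_connected_def by (elim conjE allE[of _ "{}"]) simp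
  then have "(u, v) \<in> rtrancl_on (verts ?G) ((arcs_ends ?G)\<^sup>s)"
    using assms(4,5) unfolding connected_conv by simp
  then have "(u, v) \<in> ((arcs_ends ?G)\<^sup>s)\<^sup>*" by (rule rtrancl_on_rtranclI)
  moreover have "sym (parcs H)" using pair_sym_arcs by (simp add: symmetric_def)
  then have "(arcs_ends ?G)\<^sup>s \<subseteq> parcs H"
    by (auto simp: symcl_def arcs_ends_conv dest: symD)
  ultimately show ?thesis using rtrancl_mono by blast
qed

section \<open>The minor inside one gadget\<close>

lemma symcl_iff: "(a, b) \<in> symcl R \<longleftrightarrow> (a, b) \<in> R \<or> (b, a) \<in> R"
  by (auto simp: symcl_def)

text \<open>The vertex map of the contraction; on \<open>core H z\<close> the second clause meets
  only vertices of the path.\<close>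

fun merged :: "'a \<Rightarrow> 'a gadget_vertex \<Rightarrow> 'a" where
  "merged z (Orig u) = u"
| "merged z _ = z"

definition gadget_path :: "'a \<Rightarrow> 'a gadget_vertex list" where
  "gadget_path z = [VX, VR 1, VG 1, VY, VR 2, VG 2, Orig z]"

text \<open>Contracting \<open>gadget_path z\<close> turns the subgraph of the gadget on \<open>core H z\<close>, which avoids
  \<open>z\<^sub>i'\<close>, into a supergraph of \<open>H\<close>.\<close>

definition core :: "'a pair_pre_digraph \<Rightarrow> 'a \<Rightarrow> 'a gadget_vertex set" where
  "core H z = Orig ` pverts H \<union> set (gadget_path z)"

lemma core_gadget: "z \<in> pverts H \<Longrightarrow> core H z \<subseteq> pverts (gadget H z n) - {VZ'}"
  by (auto simp: core_def gadget_path_def gadget_def Let_def)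

lemma gadget_hexagon_arc:
  assumes "(a, b) \<in> symcl {(VX, VR 1), (VR 1, VG 1), (VG 1, VY),
    (VY, VR 2), (VR 2, VG 2), (VG 2, Orig z), (Orig z, VR 3), (VR 3, VG 3), (VG 3, VX)}"
  shows "(a, b) \<in> parcs (gadget H z n)"
  unfolding gadget_def Let_def pair_pre_digraph.simps by (intro UnI1 UnI2) (rule assms)

lemma gadget_attaching_arc:
  assumes "(a, b) \<in> symcl {(Orig (n 1), VX), (Orig (n 2), VY)}" "n 1 \<noteq> z" "n 2 \<noteq> z"
  shows "(a, b) \<in> parcs (gadget H z n)"
  unfolding gadget_def Let_def pair_pre_digraph.simps
  by (rule UnI1, rule UnI1, rule DiffI, rule UnI2) (use assms in \<open>auto simp: symcl_iff\<close>)

lemma gadget_old_arc: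
  assumes "(u, v) \<in> parcs H" "(u, v) \<notin> symcl {(z, n 1), (z, n 2)}"
  shows "(Orig u, Orig v) \<in> parcs (gadget H z n)"
  unfolding gadget_def Let_def pair_pre_digraph.simps
proof (rule UnI1, rule UnI1, rule DiffI, rule UnI1, rule DiffI)
  show "(Orig u, Orig v) \<in> map_prod Orig Orig ` parcs H"
    using assms(1) by (intro image_eqI[of _ _ "(u, v)"]) auto
qed (use assms(2) in \<open>auto simp: symcl_iff\<close>)

lemma gadget_path_arcs:
  assumes "Suc i < length (gadget_path z)"
  shows "(gadget_path z ! i, gadget_path z ! Suc i) \<in> parcs (gadget H z n)"
proof (rule gadget_hexagon_arc)
  have "i = 0 \<or> i = 1 \<or> i = 2 \<or> i = 3 \<or> i = 4 \<or> i = 5" using assms by (auto simp: gadget_path_def)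
  then show "(gadget_path z ! i, gadget_path z ! Suc i) \<in> symcl {(VX, VR 1), (VR 1, VG 1), (VG 1, VY),
    (VY, VR 2), (VR 2, VG 2), (VG 2, Orig z), (Orig z, VR 3), (VR 3, VG 3), (VG 3, VX)}"
    by (elim disjE) (simp_all add: gadget_path_def symcl_iff eval_nat_numeral)
qed

text \<open>The edges from \<open>z\<close> to \<open>n 1\<close> and \<open>n 2\<close> have been
  moved to \<open>VX\<close> and \<open>VY\<close>, while the remaining one still starts at
  \<open>Orig z\<close>. All these ends lie on the path, so its contraction restores every edge at
  \<open>z\<close>; edges of \<open>H\<close> away from \<open>z\<close> are untouched.\<close>

lemma gadget_arcs:
  assumes "pair_graph H" and "{v. (z, v) \<in> parcs H} = {n 1, n 2, n 3}" and uv: "(u, v) \<in> parcs H"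
  shows "\<exists>a b. a \<in> core H z \<and> b \<in> core H z \<and> (a, b) \<in> parcs (gadget H z n) \<and> merged z a = u \<and> merged z b = v"
proof -
  interpret pair_graph H by fact
  have sym: "(y, x) \<in> parcs H" if "(x, y) \<in> parcs H" for x y
    using pair_sym_arcs that by (simp add: symmetric_def symD)
  have verts: "u \<in> pverts H" "v \<in> pverts H" using uv in_arcsD1 in_arcsD2 by auto
  have nz: "n 1 \<noteq> z" "n 2 \<noteq> z"
    using assms(2) pair_no_loops[of "(z, z)"] by auto
  have at_z: "\<exists>a \<in> core H z. merged z a = z \<and> (a, Orig w) \<in> parcs (gadget H z n) \<and> (Orig w, a) \<in> parcs (gadget H z n)"
    if w: "(z, w) \<in> parcs H" for w
  proof -
    have core: "VX \<in> core H z" "VY \<in> core H z" "Orig z \<in> core H z"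
      by (simp_all add: core_def gadget_path_def)
    have "w \<noteq> z" using pair_no_loops[OF w] by simp
    consider "w = n 1" | "w = n 2" | "w \<noteq> n 1" "w \<noteq> n 2" by blast
    then show ?thesis
    proof cases
      case 1
      have "(VX, Orig w) \<in> parcs (gadget H z n)" "(Orig w, VX) \<in> parcs (gadget H z n)"
        using 1 nz by (auto intro!: gadget_attaching_arc simp: symcl_iff)
      then show ?thesis using core by (intro bexI[of _ VX]) auto
    next
      case 2
      have "(VY, Orig w) \<in> parcs (gadget H z n)" "(Orig w, VY) \<in> parcs (gadget H z n)"
        using 2 nz by (auto intro!: gadget_attaching_arc simp: symcl_iff)
      then show ?thesis using core by (intro bexI[of _ VY]) auto
    next
      case 3
      have "(Orig z, Orig w) \<in> parcs (gadget H z n)" "(Orig w, Orig z) \<in> parcs (gadget H z n)"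
        using 3 w sym[OF w] \<open>w \<noteq> z\<close> by (auto intro!: gadget_old_arc simp: symcl_iff)
      then show ?thesis using core by (intro bexI[of _ "Orig z"]) auto
    qed
  qed
  have orig: "Orig w \<in> core H z" if "w \<in> pverts H" for w using that by (simp add: core_def)
  consider "u = z" | "v = z" | "u \<noteq> z" "v \<noteq> z" by blast
  then show ?thesis
  proof cases
    case 1
    then obtain a where "a \<in> core H z" "merged z a = z" "(a, Orig v) \<in> parcs (gadget H z n)"
      using at_z uv by blast
    then show ?thesis using 1 orig verts by (intro exI[of _ a] exI[of _ "Orig v"]) simp
  next
    case 2
    then obtain a where "a \<in> core H z" "merged z a = z" "(Orig u, a) \<in> parcs (gadget H z n)"
      using at_z sym[OF uv] by blast
    then show ?thesis using 2 orig verts by (intro exI[of _ "Orig u"] exI[of _ a]) simp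
  next
    case 3
    have "(Orig u, Orig v) \<in> parcs (gadget H z n)"
      using 3 uv by (intro gadget_old_arc) (auto simp: symcl_iff)
    then show ?thesis using orig verts by (intro exI[of _ "Orig u"] exI[of _ "Orig v"]) simp
  qed
qed

section \<open>The three pieces of the graph in a common surface\<close>

lemma big_graph_part:
  assumes "i \<in> {1, 2, 3}" and "(a, b) \<in> parcs (gadget (H i) (z i) (n i))"
    and "a \<in> core (H i) (z i)" "b \<in> core (H i) (z i)" "z i \<in> pverts (H i)"
  shows "(Part i a, Part i b) \<in> parcs (big_graph H z n \<sigma>)"
proof -
  have "a \<in> pverts (gadget (H i) (z i) (n i)) - {VZ'}" "b \<in> pverts (gadget (H i) (z i) (n i)) - {VZ'}"
    by (rule subsetD[OF core_gadget[OF assms(5)] assms(3)], rule subsetD[OF core_gadget[OF assms(5)] assms(4)])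
  then have "(Part i a, Part i b) \<in> map_prod (Part i) (Part i) `
      arcs (with_proj (gadget (H i) (z i) (n i)) \<restriction> (pverts (gadget (H i) (z i) (n i)) - {VZ'}))"
    using assms(2) by (intro image_eqI[of _ _ "(a, b)"]) auto
  then show ?thesis
    unfolding big_graph_def Let_def pair_pre_digraph.simps by (intro UnI1 UN_I[OF assms(1)])
qed

lemma big_graph_verts:
  assumes "i \<in> {1, 2, 3}" "a \<in> core (H i) (z i)" "z i \<in> pverts (H i)"
  shows "Part i a \<in> pverts (big_graph H z n \<sigma>)"
proof -
  have "a \<in> pverts (gadget (H i) (z i) (n i)) - {VZ'}" 
    by (rule subsetD[OF core_gadget[OF assms(3)] assms(2)])
  then have "Part i a \<in> Part i ` verts (with_proj (gadget (H i) (z i) (n i)) \<restriction> (pverts (gadget (H i) (z i) (n i)) - {VZ'}))"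
    by simp
  then show ?thesis
    unfolding big_graph_def Let_def pair_pre_digraph.simps by (intro insertI2 UN_I[OF assms(1)])
qed

text \<open>Three disjoint pieces give \<open>2 - \<chi> \<ge> 3\<close> on any surface, which is at
  least three crosscaps in the non-orientable case. On an orientable surface they give
  \<open>2 - \<chi> \<ge> 6\<close>, which is at least three handles.\<close>

lemma euler_char_le:
  fixes H :: "nat \<Rightarrow> 'a pair_pre_digraph" and z :: "nat \<Rightarrow> 'a" and n :: "nat \<Rightarrow> nat \<Rightarrow> 'a"
    and S :: "nat gluing"
  assumes H: "\<And>i. i \<in> {1, 2, 3} \<Longrightarrow> pair_graph (H i)"
      "\<And>i. i \<in> {1, 2, 3} \<Longrightarrow> k_connected 3 (with_proj (H i))"
      "\<And>i. i \<in> {1, 2, 3} \<Longrightarrow> \<not> planar (with_proj (H i))"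
    and z: "\<And>i. i \<in> {1, 2, 3} \<Longrightarrow> z i \<in> pverts (H i)"
    and n: "\<And>i. i \<in> {1, 2, 3} \<Longrightarrow> {v. (z i, v) \<in> parcs (H i)} = {n i 1, n i 2, n i 3}"
    and surface: "closed_surface S" "drawn_in (with_proj (big_graph H z n \<sigma>)) S"
  shows "euler_char S \<le> - 1" and "orientable S \<Longrightarrow> euler_char S \<le> - 4"
proof -
  let ?G = "big_graph H z n \<sigma>"
  interpret gluing_flags S by unfold_locales (rule surface(1))
  obtain \<phi> where "inj_on \<phi> (pverts ?G) \<and> \<phi> ` pverts ?G \<subseteq> surf_vertices S \<and>
    (\<forall>(u, v) \<in> parcs ?G. \<exists>d \<in> sides S. {\<phi> u, \<phi> v} = {vertex_at S d, vertex_at S (nx d)})"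
    using surface(2) unfolding drawn_in_def with_proj_simps by (rule exE)
  then have \<phi>: "inj_on \<phi> (pverts ?G)" "\<phi> ` pverts ?G \<subseteq> surf_vertices S"
    and "\<forall>(u, v) \<in> parcs ?G. \<exists>d \<in> sides S. {\<phi> u, \<phi> v} = {vertex_at S d, vertex_at S (nx d)}"
    by simp_all
  then have drawn: "\<exists>d \<in> sides S. {\<phi> u, \<phi> v} = {vertex_at S d, vertex_at S (nx d)}"
    if "(u, v) \<in> parcs ?G" for u v
    using that by auto
  define W where "W i = Part i ` core (H i) (z i)" for i
  define U where "U i = \<phi> ` W i" for i
  have W: "W i \<subseteq> pverts ?G" if "i \<in> {1, 2, 3}" for i
    using big_graph_verts[OF that] z[OF that] by (auto simp: W_def)
  have edge: "\<exists>e \<in> inner (U i). vl e = \<phi> a \<and> vl (f0 e) = \<phi> b"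
    if ab: "(a, b) \<in> parcs ?G" "a \<in> W i" "b \<in> W i" for a b i
  proof -
    obtain d where d: "d \<in> sides S" "{\<phi> a, \<phi> b} = {vertex_at S d, vertex_at S (nx d)}"
      using drawn[OF ab(1)] by blast
    have vl: "vl (d, True) = vertex_at S d" "vl (d, False) = vertex_at S (nx d)"
      by (simp_all add: vl_def corner_def)
    \<comment> \<open>The drawing gives the ends of an edge only as an unordered pair;
      \<open>b'\<close> selects the end that carries \<open>a\<close>.\<close>
    have "\<exists>b'. vl (d, b') = \<phi> a \<and> vl (f0 (d, b')) = \<phi> b"
    proof (cases "\<phi> a = vertex_at S d")
      case True
      then have "\<phi> b = vertex_at S (nx d)" using d(2) by (auto simp: doubleton_eq_iff)
      then show ?thesis using True vl by (intro exI[of _ True]) (simp add: f0_def)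
    next
      case False
      then have "\<phi> a = vertex_at S (nx d)" "\<phi> b = vertex_at S d"
        using d(2) by (auto simp: doubleton_eq_iff)
      then show ?thesis using vl by (intro exI[of _ False]) (simp add: f0_def)
    qed
    then obtain b' where b': "vl (d, b') = \<phi> a" "vl (f0 (d, b')) = \<phi> b" by blast
    have "(d, b') \<in> inner (U i)"
      using b' d(1) ab(2,3) by (auto simp: inner_def region_def flags_def f0_def U_def)
    then show ?thesis using b' by blast
  qed
  let ?e = "\<lambda>i. ribbon.eg f0 f1 f2 (region (U i)) (inner (U i))"
  have piece: "1 \<le> ?e i" "orientable S \<Longrightarrow> 2 \<le> ?e i" if i: "i \<in> {1, 2, 3}" for i
  proof -
    \<comment> \<open>Undo the drawing, then contract. Points of \<open>U i\<close> come from
      vertices \<open>Part i a\<close>, so the value at \<open>Hub\<close> is only a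
      default.\<close>
    define lab where "lab w = (case inv_into (W i) \<phi> w of Part _ a \<Rightarrow> merged (z i) a | Hub \<Rightarrow> z i)" for w
    have inj: "inj_on \<phi> (W i)" using \<phi>(1) W[OF i] by (rule inj_on_subset)
    have lab: "lab (\<phi> (Part i a)) = merged (z i) a" if "a \<in> core (H i) (z i)" for a
      using that inj by (simp add: lab_def W_def inv_into_f_f)
    interpret Hi: pair_graph "H i" by (rule H(1)[OF i])
    let ?ws = "map (\<lambda>a. \<phi> (Part i a)) (gadget_path (z i))"
    have path_core: "set (gadget_path (z i)) \<subseteq> core (H i) (z i)" by (auto simp: core_def)
    have U_eq: "U i = (\<lambda>a. \<phi> (Part i a)) ` core (H i) (z i)" by (auto simp: U_def W_def)
    have inj_a: "inj_on (\<lambda>a. \<phi> (Part i a)) (core (H i) (z i))"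
      using inj by (auto simp: W_def inj_on_def)
    have rest: "\<exists>u. w = \<phi> (Part i (Orig u)) \<and> u \<noteq> z i \<and> u \<in> pverts (H i)"
      if "w \<in> U i - set ?ws" for w
      using that by (auto simp: U_eq core_def gadget_path_def)
    have lab_O: "lab (\<phi> (Part i (Orig u))) = u" if "u \<in> pverts (H i)" for u
      using lab[of "Orig u"] that by (simp add: core_def)
    have g0: "inj (to_nat :: (nat \<times> bool) \<times> bool \<Rightarrow> nat)" by simp
    have g1: "\<And>u. (u, u) \<notin> parcs (H i)" using Hi.pair_no_loops by fastforce
    have g2: "\<And>u v. u \<in> pverts (H i) \<Longrightarrow> v \<in> pverts (H i) \<Longrightarrow> (u, v) \<in> (parcs (H i))\<^sup>*"
      using reachable_if_k_connected[OF H(1,2)[OF i]] by simp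
    have g3: "U i \<subseteq> surf_vertices S" using \<phi>(2) W[OF i] by (auto simp: U_def)
    have g4: "?ws \<noteq> []" by (simp add: gadget_path_def)
    have g5: "distinct ?ws"
      unfolding distinct_map using inj_on_subset[OF inj_a path_core] by (simp add: gadget_path_def)
    have g6: "set ?ws \<subseteq> U i" using path_core by (auto simp: U_eq)
    have g7: "lab w = z i" if "w \<in> set ?ws" for w
    proof -
      obtain a where a: "a \<in> set (gadget_path (z i))" "w = \<phi> (Part i a)" using \<open>w \<in> set ?ws\<close> by auto
      then have "merged (z i) a = z i" by (auto simp: gadget_path_def)
      then show ?thesis using a lab path_core by auto
    qed
    have g8: "\<exists>e \<in> inner (U i). vl e = ?ws ! k \<and> vl (f0 e) = ?ws ! Suc k" if "Suc k < length ?ws" for k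
    proof -
      have k: "Suc k < length (gadget_path (z i))" using that by simp
      have in_core: "gadget_path (z i) ! k \<in> core (H i) (z i)" "gadget_path (z i) ! Suc k \<in> core (H i) (z i)"
        using k path_core by (auto dest: nth_mem)
      have "(Part i (gadget_path (z i) ! k), Part i (gadget_path (z i) ! Suc k)) \<in> parcs ?G"
        by (rule big_graph_part[of i _ _ H z n, OF i gadget_path_arcs[OF k] in_core z[OF i]])
      from edge[OF this, of i] in_core show ?thesis using k by (simp add: W_def)
    qed
    have g9: "inj_on lab (U i - set ?ws)"
    proof (rule inj_onI)
      fix v w assume vw: "v \<in> U i - set ?ws" "w \<in> U i - set ?ws" "lab v = lab w"
      show "v = w" using rest[OF vw(1)] rest[OF vw(2)] vw(3) lab_O by auto
    qed
    have g10: "z i \<notin> lab ` (U i - set ?ws)"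
    proof
      assume "z i \<in> lab ` (U i - set ?ws)"
      then obtain w where "w \<in> U i - set ?ws" "lab w = z i" by auto
      then show False using rest[of w] lab_O by auto
    qed
    have g11: "lab ` U i = pverts (H i)"
    proof -
      have "lab ` U i = merged (z i) ` core (H i) (z i)"
        unfolding U_eq image_image using lab by (intro image_cong) auto
      also have "\<dots> = pverts (H i)"
        using z[OF i] by (force simp: core_def gadget_path_def image_iff)
      finally show ?thesis .
    qed
    have g12: "\<exists>e \<in> inner (U i). lab (vl e) = u \<and> lab (vl (f0 e)) = v" if uv: "(u, v) \<in> parcs (H i)" for u v
    proof -
      obtain a b where ab: "a \<in> core (H i) (z i)" "b \<in> core (H i) (z i)"
        "(a, b) \<in> parcs (gadget (H i) (z i) (n i))" "merged (z i) a = u" "merged (z i) b = v"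
        using gadget_arcs[OF H(1)[OF i] n[OF i] uv] by blast
      have "(Part i a, Part i b) \<in> parcs ?G"
        by (rule big_graph_part[of i _ _ H z n, OF i ab(3,1,2) z[OF i]])
      from edge[OF this, of i] ab(1,2)
      obtain e where "e \<in> inner (U i)" "vl e = \<phi> (Part i a)" "vl (f0 e) = \<phi> (Part i b)"
        by (auto simp: W_def)
      then show ?thesis using ab lab by (intro bexI[of _ e]) simp_all
    qed
    show "1 \<le> ?e i" "orientable S \<Longrightarrow> 2 \<le> ?e i"
      using eg_region_nonplanar[OF g0 H(3)[OF i] g1 g2 g3 g4 g5 g6 g7 g8 g9 g10 g11 g12] by blast+
  qed
  have disj: "U i \<inter> U j = {}" if "i \<noteq> j" "i \<in> {1, 2, 3}" "j \<in> {1, 2, 3}" for i j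
  proof -
    have "W i \<inter> W j = {}" using that(1) by (auto simp: W_def)
    then show ?thesis unfolding U_def using \<phi>(1) W that(2,3) by (metis inj_on_image_Int image_empty)
  qed
  have "?e 1 + ?e 2 + ?e 3 \<le> 2 - euler_char S"
    using eg_three_regions[of "U 1" "U 2" "U 3"] disj eg_flags by simp
  then show "euler_char S \<le> - 1" "orientable S \<Longrightarrow> euler_char S \<le> - 4"
    using piece[of 1] piece[of 2] piece[of 3] by auto
qed

theorem theorem3:
  fixes H :: "nat \<Rightarrow> 'a pair_pre_digraph"
    and z :: "nat \<Rightarrow> 'a"
    and n :: "nat \<Rightarrow> nat \<Rightarrow> 'a"
    and \<sigma> :: "nat \<Rightarrow> nat \<Rightarrow> nat"
  assumes "\<And>i. i \<in> {1, 2, 3} \<Longrightarrow> pair_graph (H i)"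
    and "\<And>i. i \<in> {1, 2, 3} \<Longrightarrow> k_connected 3 (with_proj (H i))"
    and "\<And>i. i \<in> {1, 2, 3} \<Longrightarrow> cubic (with_proj (H i))"
    and "\<And>i. i \<in> {1, 2, 3} \<Longrightarrow> \<not> planar (with_proj (H i))"
    and "\<And>i. i \<in> {1, 2, 3} \<Longrightarrow> hypohamiltonian (with_proj (H i))"
    and "\<And>i. i \<in> {1, 2, 3} \<Longrightarrow> z i \<in> pverts (H i)"
    and "\<And>i. i \<in> {1, 2, 3} \<Longrightarrow> {v. (z i, v) \<in> parcs (H i)} = {n i 1, n i 2, n i 3}"
    and "\<And>i. i \<in> {1, 2, 3} \<Longrightarrow> bij_betw (\<sigma> i) {1, 2, 3} {1, 2, 3}"
  shows "orientable_genus (with_proj (big_graph H z n \<sigma>)) \<ge> 3 \<and>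
         nonorientable_genus (with_proj (big_graph H z n \<sigma>)) \<ge> 3"
proof
  note chi = euler_char_le[of H z n, OF assms(1,2,4,6,7)]
  have "(3 :: enat) \<le> enat g" if "3 \<le> g" for g
    using that by (simp add: numeral_eq_enat)
  moreover have "3 \<le> g" if "embeds_orientable (with_proj (big_graph H z n \<sigma>)) g" for g
    using that chi(2) unfolding embeds_orientable_def by fastforce
  ultimately show "orientable_genus (with_proj (big_graph H z n \<sigma>)) \<ge> 3"
    unfolding orientable_genus_def by (intro Inf_greatest) auto
  have "(3 :: enat) \<le> enat g" if "3 \<le> g" for g
    using that by (simp add: numeral_eq_enat)
  moreover have "3 \<le> k" if "embeds_nonorientable (with_proj (big_graph H z n \<sigma>)) k" for k
    using that chi(1) unfolding embeds_nonorientable_def by fastforce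
  ultimately show "nonorientable_genus (with_proj (big_graph H z n \<sigma>)) \<ge> 3"
    unfolding nonorientable_genus_def by (intro Inf_greatest) auto
qed

end
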